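(* Let $W$ be a compact metric space, $\varphi\colon\mathbb{R}_+\times W\to W$, $(t,w)\mapsto t\cdot w$, a continuous semiflow, and let $X\in\mathrm{C}(W,\mathbb{R}^{d\times d})$ be robustly periodically stable driven by $\varphi$. Then there are constants $\eta<0$ and $\boldsymbol{T}>0$ such that, if $w\in W$ is a periodic point of $\varphi$ of period $\pi_w\ge\boldsymbol{T}$ and if $0=t_0<t_1<\cdots<t_\ell=\pi_w$, $\ell\ge1$, is a subdivision of the interval $[0,\pi_w]$ satisfying $t_k-t_{k-1}\ge\boldsymbol{T}$ for $k=1,\dots,\ell$, then $$\frac{1}{\pi_w}\sum_{k=1}^{\ell}\log\|\mathscr{X}(t_k-t_{k-1},\,t_{k-1}\cdot w)\|\le\eta.$$
   Context: $\mathbb{R}_+=[0,\infty)$, $d\ge1$ is an integer. $\|\cdot\|$ is the matrix norm on $\mathbb{R}^{d\times d}$ induced by a fixed vector norm on $\mathbb{R}^d$. $\mathrm{C}(W,\mathbb{R}^{d\times d})$ is the space of continuous maps $W\to\mathbb{R}^{d\times d}$ with $\|X\|=\sup_{w\in W}\|X(w)\|$. For $X\in\mathrm{C}(W,\mathbb{R}^{d\times d})$ and $w\in W$, $\mathscr{X}(t,w)$, $t\ge0$, is the fundamental matrix solution of $\dot x(t)=X(t\cdot w)x(t)$ with $\mathscr{X}(0,w)=I_d$; similarly $\mathscr{Y}(t,w)$ for $Y$. A point $w\in W$ is a periodic point of $\varphi$ of period $\tau>0$ if $w=\tau\cdot w$; fixed points of $\varphi$ are counted among the periodic points. $X$ is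 robustly periodically stable driven by $\varphi$ if there is $\varepsilon>0$ such that for every $Y\in\mathrm{C}(W,\mathbb{R}^{d\times d})$ with $\|X-Y\|<\varepsilon$ and every periodic or fixed point $\tilde w$ of $\varphi$ there are constants $K_{Y,\tilde w}>0$ and $0<\gamma_{Y,\tilde w}<1$ with $\|\mathscr{Y}(t,\tilde w)\|\le K_{Y,\tilde w}\,\gamma_{Y,\tilde w}^{\,t}$ for all $t\ge0$. *)

theory Defs
  imports "HOL-Analysis.Analysis"
begin

definition vector_norm :: "(real^'n \<Rightarrow> real) \<Rightarrow> bool" where
  "vector_norm N \<longleftrightarrow>
     (\<forall>x. 0 \<le> N x) \<and> (\<forall>x. N x = 0 \<longleftrightarrow> x = 0) \<and>
     (\<forall>c x. N (c *\<^sub>R x) = \<bar>c\<bar> * N x) \<and> (\<forall>x y. N (x + y) \<le> N x + N y)"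

text \<open>The norm on matrices induced by the vector norm \<open>N\<close>. The library's
  \<^const>\<open>onorm\<close> covers only the Euclidean norm.\<close>

definition matrix_norm :: "(real^'n \<Rightarrow> real) \<Rightarrow> real^'n^'n \<Rightarrow> real" where
  "matrix_norm N A = (SUP x\<in>{x. N x = 1}. N (A *v x))"

text \<open>The elements of $C(W, R^{d \times d})$ are the functions continuous on \<open>W\<close>;
  their values outside \<open>W\<close> play no role.\<close>

definition sup_norm_on ::
  "(real^'n \<Rightarrow> real) \<Rightarrow> 'w set \<Rightarrow> ('w \<Rightarrow> real^'n^'n) \<Rightarrow> real" where
  "sup_norm_on N W X = (SUP w\<in>W. matrix_norm N (X w))"

text \<open>A semiflow has time set $[0,\infty)$; the values \<open>\<phi> t w\<close> for \<open>t < 0\<close> play no role.\<close>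

definition continuous_semiflow_on ::
  "'w::metric_space set \<Rightarrow> (real \<Rightarrow> 'w \<Rightarrow> 'w) \<Rightarrow> bool" where
  "continuous_semiflow_on W \<phi> \<longleftrightarrow>
     (\<forall>t\<ge>0. \<forall>w\<in>W. \<phi> t w \<in> W) \<and>
     (\<forall>w\<in>W. \<phi> 0 w = w) \<and>
     (\<forall>s\<ge>0. \<forall>t\<ge>0. \<forall>w\<in>W. \<phi> (s + t) w = \<phi> s (\<phi> t w)) \<and>
     continuous_on ({0..} \<times> W) (\<lambda>(t, w). \<phi> t w)"

text \<open>The period need not be minimal, so a fixed point has every \<open>\<tau> > 0\<close> as a period.\<close>

definition periodic_point ::
  "'w set \<Rightarrow> (real \<Rightarrow> 'w \<Rightarrow> 'w) \<Rightarrow> 'w \<Rightarrow> real \<Rightarrow> bool" where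
  "periodic_point W \<phi> w \<tau> \<longleftrightarrow> w \<in> W \<and> \<tau> > 0 \<and> w = \<phi> \<tau> w"

definition is_fundamental_solution ::
  "(real \<Rightarrow> 'w \<Rightarrow> 'w) \<Rightarrow> ('w \<Rightarrow> real^'n^'n) \<Rightarrow> 'w \<Rightarrow> (real \<Rightarrow> real^'n^'n) \<Rightarrow> bool" where
  "is_fundamental_solution \<phi> X w F \<longleftrightarrow>
     F 0 = mat 1 \<and>
     (\<forall>t\<ge>0. (F has_vector_derivative (X (\<phi> t w) ** F t)) (at t within {0..}))"

text \<open>A solution is determined only on $[0,\infty)$, so its value at \<open>t\<close> is described
  rather than the whole function. For \<open>w\<close> in \<open>W\<close>, \<open>X\<close> continuous on \<open>W\<close> and \<open>t \<ge> 0\<close> that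
  value exists and is unique, the equation being linear with continuous coefficients.\<close>

definition fundamental_matrix ::
  "(real \<Rightarrow> 'w \<Rightarrow> 'w) \<Rightarrow> ('w \<Rightarrow> real^'n^'n) \<Rightarrow> real \<Rightarrow> 'w \<Rightarrow> real^'n^'n" where
  "fundamental_matrix \<phi> X t w = (THE M. \<exists>F. is_fundamental_solution \<phi> X w F \<and> F t = M)"

definition robustly_periodically_stable ::
  "(real^'n \<Rightarrow> real) \<Rightarrow> 'w::metric_space set \<Rightarrow> (real \<Rightarrow> 'w \<Rightarrow> 'w) \<Rightarrow>
   ('w \<Rightarrow> real^'n^'n) \<Rightarrow> bool" where
  "robustly_periodically_stable N W \<phi> X \<longleftrightarrow>
     (\<exists>\<epsilon>>0. \<forall>Y. continuous_on W Y \<and> sup_norm_on N W (\<lambda>w. X w - Y w) < \<epsilon> \<longrightarrow>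
        (\<forall>w \<tau>. periodic_point W \<phi> w \<tau> \<longrightarrow>
           (\<exists>K \<gamma>. K > 0 \<and> 0 < \<gamma> \<and> \<gamma> < 1 \<and>
              (\<forall>t\<ge>0. matrix_norm N (fundamental_matrix \<phi> Y t w) \<le> K * \<gamma> powr t))))"

end

theory Submission
  imports Defs
begin

text \<open>Let \<open>w\<close> have minimal period \<open>p\<close> and cut \<open>[0, p]\<close> into \<open>m\<close> equal cells with transition
  matrices \<open>A\<^sub>j\<close>. A small bump supported in the first unit of time of a cell turns \<open>A\<^sub>j\<close> into
  \<open>A\<^sub>j (1 + s\<^sub>j E\<^sub>j)\<close> with a matrix unit \<open>E\<^sub>j\<close> and \<open>\<bar>s\<^sub>j\<bar> \<le> \<delta>\<close>. Suitable \<open>E\<^sub>j\<close> and signs make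
  the trace of the product at least a constant per cell times the product of the norms of the \<open>A\<^sub>j\<close>.
  If one also adds a small multiple \<open>k\<close> of the identity to \<open>X\<close>, the period map still has bounded
  powers, hence trace at most \<open>2 d\<close>. So the sum of the \<open>ln \<parallel>A\<^sub>j\<parallel>\<close> is at most \<open>- k p\<close> plus
  a constant per cell, which is absorbed by taking long cells. An arbitrary subdivision of a multiple
  of \<open>p\<close> is then compared with this grid, at a bounded cost per segment.

  The bumps need \<open>p\<close> to be large. Points with a period in \<open>(0, T]\<close> have a period in
  \<open>[T, 2 T]\<close>, and the points of the latter kind form a compact set, on which pointwise stability
  of \<open>X\<close> itself gives a uniform exponential bound.\<close>

subsection \<open>Matrix norms\<close>

text \<open>Robust stability supplies constants that depend on \<open>Y\<close> and on the point, so
  it gives no uniform bound on the norm of a perturbed period map. The trace is the substitute: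
  power boundedness with any constant whatsoever bounds it in terms of the dimension alone. The
  added multiple of the identity scales the period map by \<open>exp (k * p)\<close>, and this
  factor is the source of the decay rate. A perturbation must be a function on \<open>W\<close>,
  whereas it is designed as a function of time along one orbit. On a minimal period different times
  in \<open>[0, p)\<close> give different points, so it descends to the orbit; a Tietze extension
  with controlled sup norm carries it to \<open>W\<close>. The loss per cell depends on \<delta> and
  is beaten by making cells long, so \<delta> must not depend on the cell length. This is why each
  bump is confined to one unit of time: its size involves the growth over time 1 only.\<close>

lemma norm_vec_sq: "(norm (x::real^'n))\<^sup>2 = (\<Sum>i\<in>UNIV. (x$i)\<^sup>2)"
  by (simp add: norm_vec_def L2_set_def sum_nonneg)

lemma norm_mat_sq: "(norm (A::real^'n^'m))\<^sup>2 = (\<Sum>i\<in>UNIV. \<Sum>j\<in>UNIV. (A$i$j)\<^sup>2)"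
  by (simp add: norm_vec_def[of A] L2_set_def sum_nonneg norm_vec_sq)

text \<open>Cauchy-Schwarz in each entry. On these types \<open>norm\<close> is the Frobenius norm;
  all estimates before the final theorem use it, and the induced norm enters only through
  \<open>matrix_norm_equivalent\<close>.\<close>

lemma norm_matrix_matrix_mult_le:
  fixes A :: "real^'n^'m" and B :: "real^'k^'n"
  shows "norm (A ** B) \<le> norm A * norm B"
proof (rule power2_le_imp_le)
  have "(norm (A ** B))\<^sup>2 = (\<Sum>i\<in>UNIV. \<Sum>j\<in>UNIV. (\<Sum>k\<in>UNIV. A$i$k * B$k$j)\<^sup>2)"
    by (simp add: norm_mat_sq matrix_matrix_mult_def)
  also have "\<dots> \<le> (\<Sum>i\<in>UNIV. \<Sum>j\<in>UNIV. (\<Sum>k\<in>UNIV. (A$i$k)\<^sup>2) * (\<Sum>k\<in>UNIV. (B$k$j)\<^sup>2))"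
    by (intro sum_mono Cauchy_Schwarz_ineq_sum)
  also have "\<dots> = (\<Sum>i\<in>UNIV. \<Sum>k\<in>UNIV. (A$i$k)\<^sup>2) * (\<Sum>j\<in>UNIV. \<Sum>k\<in>UNIV. (B$k$j)\<^sup>2)"
    by (simp add: sum_product)
  also have "(\<Sum>j\<in>UNIV. \<Sum>k\<in>UNIV. (B$k$j)\<^sup>2) = (\<Sum>k\<in>UNIV. \<Sum>j\<in>UNIV. (B$k$j)\<^sup>2)"
    by (rule sum.swap)
  finally show "(norm (A ** B))\<^sup>2 \<le> (norm A * norm B)\<^sup>2"
    by (simp add: norm_mat_sq power_mult_distrib)
qed simp

lemma norm_matrix_vector_mult_le:
  fixes A :: "real^'n^'m" and x :: "real^'n"
  shows "norm (A *v x) \<le> norm A * norm x"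
proof (rule power2_le_imp_le)
  have "(norm (A *v x))\<^sup>2 = (\<Sum>i\<in>UNIV. (\<Sum>k\<in>UNIV. A$i$k * x$k)\<^sup>2)"
    by (simp add: norm_vec_sq matrix_vector_mult_def)
  also have "\<dots> \<le> (\<Sum>i\<in>UNIV. (\<Sum>k\<in>UNIV. (A$i$k)\<^sup>2) * (\<Sum>k\<in>UNIV. (x$k)\<^sup>2))"
    by (intro sum_mono Cauchy_Schwarz_ineq_sum)
  also have "\<dots> = (\<Sum>i\<in>UNIV. \<Sum>k\<in>UNIV. (A$i$k)\<^sup>2) * (\<Sum>k\<in>UNIV. (x$k)\<^sup>2)"
    by (simp add: sum_distrib_right)
  finally show "(norm (A *v x))\<^sup>2 \<le> (norm A * norm x)\<^sup>2"
    by (simp add: norm_mat_sq norm_vec_sq power_mult_distrib)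
qed simp

lemma abs_entry_le_norm: "\<bar>A$i$j\<bar> \<le> norm (A::real^'n^'m)"
  using component_le_norm_cart[of "A$i" j] Finite_Cartesian_Product.norm_nth_le[of A i] by simp

lemma norm_matrix_le_card:
  fixes A :: "real^'n^'n"
  assumes "\<And>i j. \<bar>A$i$j\<bar> \<le> c"
  shows "norm A \<le> (real CARD('n))\<^sup>2 * c"
proof -
  have "norm (A$i) \<le> real CARD('n) * c" for i
  proof -
    have "norm (A$i) \<le> (\<Sum>j\<in>UNIV. \<bar>A$i$j\<bar>)" by (rule norm_le_l1_cart)
    also have "\<dots> \<le> real CARD('n) * c" using assms sum_bounded_above[of UNIV "\<lambda>j. \<bar>A$i$j\<bar>" c] by simp
    finally show ?thesis .
  qed
  then have "(\<Sum>i\<in>UNIV. norm (A$i)) \<le> real CARD('n) * (real CARD('n) * c)"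
    using sum_bounded_above[of UNIV "\<lambda>i. norm (A$i)"] by simp
  moreover have "norm A \<le> (\<Sum>i\<in>UNIV. norm (A$i))"
    by (simp add: norm_vec_def L2_set_le_sum)
  ultimately show ?thesis by (simp add: power2_eq_square)
qed

lemma exists_large_entry:
  fixes A :: "real^'n^'n"
  obtains i j where "norm A \<le> (real CARD('n))\<^sup>2 * \<bar>A$i$j\<bar>"
proof -
  define c where "c = Max (range (\<lambda>(i,j). \<bar>A$i$j\<bar>))"
  have "c \<in> range (\<lambda>(i,j). \<bar>A$i$j\<bar>)" unfolding c_def by (rule Max_in) auto
  then obtain i j where ij: "c = \<bar>A$i$j\<bar>" by auto
  have "\<bar>A$k$l\<bar> \<le> c" for k l
    unfolding c_def by (rule Max_ge) (auto intro: rev_image_eqI[of "(k,l)"])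
  from norm_matrix_le_card[OF this] ij that show ?thesis by auto
qed

lemma bounded_bilinear_matrix_matrix_mult:
  "bounded_bilinear ((**) :: real^'n^'m \<Rightarrow> real^'k^'n \<Rightarrow> real^'k^'m)"
proof
  show "\<exists>K. \<forall>A B. norm ((A :: real^'n^'m) ** (B :: real^'k^'n)) \<le> norm A * norm B * K"
    by (rule exI[of _ 1]) (simp add: norm_matrix_matrix_mult_le)
qed (auto simp: matrix_matrix_mult_def vec_eq_iff algebra_simps sum.distrib sum_distrib_left)

lemmas has_vector_derivative_matrix_mult =
  bounded_bilinear.has_vector_derivative[OF bounded_bilinear_matrix_matrix_mult]
lemmas continuous_on_matrix_mult =
  bounded_bilinear.continuous_on[OF bounded_bilinear_matrix_matrix_mult]

lemma norm_transpose: "norm (transpose A) = norm (A::real^'n^'m)"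
proof -
  have "(norm (transpose A))\<^sup>2 = (norm A)\<^sup>2"
    by (simp add: norm_mat_sq transpose_def) (rule sum.swap)
  then show ?thesis by simp
qed

lemma bounded_linear_transpose: "bounded_linear (transpose :: real^'n^'m \<Rightarrow> real^'m^'n)"
  by (rule bounded_linear_intro[where K=1]) (auto simp: norm_transpose, auto simp: transpose_def vec_eq_iff)

text \<open>Coordinates bound \<open>N\<close> from above, so \<open>N\<close> is Lipschitz and
  attains a positive minimum on the Euclidean unit sphere; the larger of the two constants serves
  both directions.\<close>

lemma vector_norm_equivalent:
  fixes N :: "real^'n \<Rightarrow> real"
  assumes "vector_norm N"
  obtains C where "0 < C" "\<And>x. N x \<le> C * norm x" "\<And>x. norm x \<le> C * N x"
proof -
  have N: "\<And>x. 0 \<le> N x" "\<And>x. N x = 0 \<longleftrightarrow> x = 0" "\<And>c x. N (c *\<^sub>R x) = \<bar>c\<bar> * N x"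
    "\<And>x y. N (x + y) \<le> N x + N y"
    using assms by (auto simp: vector_norm_def)
  define a where "a = (\<Sum>i\<in>UNIV. N (axis i (1::real)))"
  have a0: "0 \<le> a" unfolding a_def by (intro sum_nonneg N)
  have Nsum: "N (sum f S) \<le> (\<Sum>i\<in>S. N (f i))" for f and S :: "'n set"
    using N(2)[of 0] by (induction S rule: infinite_finite_induct) (auto intro: order.trans[OF N(4)])
  have up: "N x \<le> a * norm x" for x :: "real^'n"
  proof -
    have "N x = N (\<Sum>i\<in>UNIV. x$i *\<^sub>R axis i 1)"
      using basis_expansion[of x] by (simp add: scalar_mult_eq_scaleR)
    also have "\<dots> \<le> (\<Sum>i\<in>UNIV. \<bar>x$i\<bar> * N (axis i 1))" using Nsum by (simp flip: N(3))
    also have "\<dots> \<le> (\<Sum>i\<in>UNIV. norm x * N (axis i 1))"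
      by (intro sum_mono mult_right_mono component_le_norm_cart N)
    finally show ?thesis by (simp add: a_def sum_distrib_left mult.commute)
  qed
  have lip: "\<bar>N x - N y\<bar> \<le> a * norm (x - y)" for x y
  proof -
    have "N x \<le> N (x - y) + N y" "N y \<le> N (y - x) + N x" using N(4)[of "x - y" y] N(4)[of "y - x" x] by auto
    moreover have "N (y - x) = N (x - y)" using N(3)[of "-1" "x - y"] by simp
    ultimately show ?thesis using up[of "x - y"] by linarith
  qed
  have "a-lipschitz_on (sphere 0 1) N"
    by (rule lipschitz_onI) (use lip a0 in \<open>auto simp: dist_norm\<close>)
  then have "continuous_on (sphere 0 1) N" by (rule lipschitz_on_continuous_on)
  moreover have "sphere (0::real^'n) 1 \<noteq> {}" by (auto intro: exI[of _ "axis undefined 1"])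
  ultimately obtain u :: "real^'n" where u: "norm u = 1" "\<And>x. norm x = 1 \<Longrightarrow> N u \<le> N x"
    using continuous_attains_inf[OF compact_sphere[of "0::real^'n" 1], of N] by auto
  have "u \<noteq> 0" using u(1) by auto
  then have Nu: "0 < N u" using N(1,2)[of u] by linarith
  have low: "norm x \<le> (1 / N u) * N x" for x
  proof (cases "x = 0")
    case False
    have "N u \<le> N ((1 / norm x) *\<^sub>R x)" using False by (intro u) auto
    also have "\<dots> = N x / norm x" by (simp only: N(3)) simp
    finally show ?thesis using False Nu by (simp add: field_simps)
  qed (use N in auto)
  have le_max: "c * r \<le> max c d * r" "d * r \<le> max c d * r" if "0 \<le> r" for c d r :: real
    using that by (auto intro: mult_right_mono)
  show thesis
  proof (rule that[of "max a (1 / N u)"])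
    show "0 < max a (1 / N u)" using Nu by (simp add: less_max_iff_disj)
    show "N x \<le> max a (1 / N u) * norm x" for x
      using up[of x] le_max(1)[of "norm x" a "1 / N u"] by auto
    show "norm x \<le> max a (1 / N u) * N x" for x
      using low[of x] le_max(2)[OF N(1)[of x], of "1 / N u" a] by linarith
  qed
qed

lemma matrix_norm_equivalent:
  fixes N :: "real^'n \<Rightarrow> real"
  assumes "vector_norm N"
  obtains C where "0 < C" "\<And>A. matrix_norm N A \<le> C * norm A" "\<And>A. norm A \<le> C * matrix_norm N A"
proof -
  from vector_norm_equivalent[OF assms]
  obtain C where C: "0 < C" "\<And>x. N x \<le> C * norm x" "\<And>x. norm x \<le> C * N x" by blast
  have N: "\<And>x. 0 \<le> N x" "\<And>x. N x = 0 \<longleftrightarrow> x = 0" "\<And>c x. N (c *\<^sub>R x) = \<bar>c\<bar> * N x"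
    using assms by (auto simp: vector_norm_def)
  have le: "N (A *v x) \<le> C\<^sup>2 * norm A" if "N x = 1" for A x
  proof -
    have "N (A *v x) \<le> C * (norm A * (C * N x))"
      using C norm_ge_zero
      by (intro order.trans[OF C(2)] mult_left_mono order.trans[OF norm_matrix_vector_mult_le]) auto
    with that show ?thesis by (simp add: power2_eq_square mult_ac)
  qed
  have bdd: "bdd_above ((\<lambda>x. N (A *v x)) ` {x. N x = 1})" for A
    using le by (intro bdd_aboveI[of _ "C\<^sup>2 * norm A"]) auto
  \<comment> \<open>The supremum defining \<open>matrix_norm\<close> needs a nonempty index set; a
    normalised axis vector is a witness.\<close>
  have "N (axis undefined 1) \<noteq> 0" using N(2) by (simp add: axis_eq_0_iff)
  then have "N ((1 / N (axis undefined 1)) *\<^sub>R axis undefined 1) = 1"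
    by (simp only: N(3)) (use N(1) in simp)
  then have "{x. N x = 1} \<noteq> {}" by blast
  then have up: "matrix_norm N A \<le> C\<^sup>2 * norm A" for A
    unfolding matrix_norm_def using le by (intro cSUP_least) auto
  have op: "N (A *v x) \<le> matrix_norm N A * N x" for A x
  proof (cases "x = 0")
    case False
    then have pos: "0 < N x" using N(1,2)[of x] by linarith
    have "N ((1 / N x) *\<^sub>R x) = 1" using pos by (simp only: N(3)) simp
    then have "N (A *v ((1 / N x) *\<^sub>R x)) \<le> matrix_norm N A"
      unfolding matrix_norm_def by (intro cSUP_upper bdd) auto
    also have "A *v ((1 / N x) *\<^sub>R x) = (1 / N x) *\<^sub>R (A *v x)"
      by (rule linear_cmul[OF matrix_vector_mul_linear])
    finally show ?thesis using pos by (simp only: N(3)) (simp add: field_simps)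
  qed (use N(2)[of 0] in simp)
  have low: "norm A \<le> (real CARD('n))\<^sup>2 * (C\<^sup>2 * matrix_norm N A)" for A
  proof (rule norm_matrix_le_card)
    fix i j
    have "(A *v axis j 1) $ i = A $ i $ j"
      by (simp add: matrix_vector_mult_def axis_def if_distrib cong: if_cong)
    then have "\<bar>A $ i $ j\<bar> \<le> norm (A *v axis j 1)"
      using component_le_norm_cart[of "A *v axis j 1" i] by simp
    also have "\<dots> \<le> C * N (A *v axis j 1)" by (rule C)
    also have "\<dots> \<le> C * (matrix_norm N A * N (axis j 1))" using C op by (intro mult_left_mono) auto
    also have "\<dots> \<le> C * (matrix_norm N A * (C * norm (axis j (1::real))))"
    proof -
      have "0 \<le> matrix_norm N A"
        using op[of A "axis j 1"] N(1)[of "A *v axis j 1"] N(1)[of "axis j 1"] N(2)[of "axis j 1"]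
        by (metis axis_eq_0_iff mult_less_0_iff not_le order_antisym_conv order_trans zero_neq_one)
      with C(1) C(2)[of "axis j 1"] show ?thesis by (intro mult_left_mono) auto
    qed
    finally show "\<bar>A $ i $ j\<bar> \<le> C\<^sup>2 * matrix_norm N A"
      by (simp add: power2_eq_square mult_ac norm_axis_1)
  qed
  show thesis
  proof (rule that[of "(real CARD('n))\<^sup>2 * C\<^sup>2"])
    have "1 \<le> (real CARD('n))\<^sup>2" by (simp add: Suc_leI)
    from mult_right_mono[OF this, of "C\<^sup>2 * norm A" for A :: "real^'n^'n"]
    have "C\<^sup>2 * norm A \<le> (real CARD('n))\<^sup>2 * C\<^sup>2 * norm A" for A :: "real^'n^'n"
      by (simp add: mult.assoc)
    then show "matrix_norm N A \<le> (real CARD('n))\<^sup>2 * C\<^sup>2 * norm A" for A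
      using up[of A] order_trans by blast
  qed (use C low in \<open>auto simp: mult_ac\<close>)
qed

lemma matrix_inv_eqI: "(G::real^'n^'n) ** F = mat 1 \<Longrightarrow> F ** G = mat 1 \<Longrightarrow> matrix_inv F = G"
  unfolding matrix_inv_def
  by (rule some_equality) (metis matrix_mul_assoc matrix_mul_lid matrix_mul_rid)+

subsection \<open>Traces of perturbed products\<close>

text \<open>Leibniz expansion. Only finiteness matters: it makes the supremum of determinants in the
  trace bound exist.\<close>

lemma abs_det_le_card:
  fixes E :: "real^'n^'n"
  assumes "\<And>i j. \<bar>E$i$j\<bar> \<le> 1"
  shows "\<bar>det E\<bar> \<le> real (card {p. p permutes (UNIV::'n set)})"
proof -
  have "\<bar>det E\<bar> \<le> (\<Sum>p | p permutes (UNIV::'n set). \<bar>of_int (sign p) * (\<Prod>i\<in>UNIV. E$i$p i)\<bar>)"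
    unfolding det_def by (rule sum_abs)
  also have "\<dots> \<le> (\<Sum>p | p permutes (UNIV::'n set). 1)"
  proof (rule sum_mono)
    fix p :: "'n \<Rightarrow> 'n"
    have "(\<Prod>i\<in>UNIV. \<bar>E$i$p i\<bar>) \<le> 1" using assms by (intro prod_le_1) auto
    then show "\<bar>of_int (sign p) * (\<Prod>i\<in>UNIV. E$i$p i)\<bar> \<le> 1"
      by (simp add: abs_mult abs_prod sign_def)
  qed
  finally show ?thesis by simp
qed

lemma column_mult: "column k (A ** B) = A *v column k (B :: real^'m^'n)"
  by (simp add: column_def vec_eq_iff matrix_vector_mult_def matrix_matrix_mult_def)

text \<open>In a basis of vectors from the bounded \<open>Q\<close>-invariant set \<open>B\<close> whose determinant is nearly
  maximal, Cramer's rule bounds every diagonal entry of \<open>Q\<close> by \<open>2\<close>.\<close>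

lemma abs_trace_le_of_bounded_powers:
  fixes Q :: "real^'n^'n"
  assumes bd: "\<And>n. norm (((**) Q ^^ n) (mat 1)) \<le> K"
  shows "\<bar>trace Q\<bar> \<le> 2 * real CARD('n)"
proof -
  define q where "q n = ((**) Q ^^ n) (mat 1)" for n
  have q0: "q 0 = mat 1" and qS: "q (Suc n) = Q ** q n" for n by (auto simp: q_def)
  have qS': "q (Suc n) = q n ** Q" for n
  proof (induction n)
    case (Suc n)
    then show ?case by (metis qS matrix_mul_assoc)
  qed (simp add: q0 qS)
  \<comment> \<open>The unit ball of the adapted norm sup over \<open>n\<close> of
    \<open>norm (q n *v x)\<close>, in which \<open>Q\<close> does not expand.\<close>
  define B where "B = {x :: real^'n. \<forall>n. norm (q n *v x) \<le> 1}"
  have B1: "norm x \<le> 1" if "x \<in> B" for x using that[unfolded B_def] q0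
    by (metis (mono_tags, lifting) matrix_vector_mul_lid mem_Collect_eq)
  have BQ: "Q *v x \<in> B" if "x \<in> B" for x
  proof -
    have "q n *v (Q *v x) = q (Suc n) *v x" for n by (simp add: qS' matrix_vector_mul_assoc)
    with that show ?thesis by (auto simp: B_def)
  qed
  have K0: "0 \<le> K" using bd[of 0] norm_ge_zero order_trans by blast
  \<comment> \<open>\<open>K\<close> enters only through this scale, which puts a basis into
    \<open>B\<close> and makes \<open>M\<close> positive; the final bound is free of it.\<close>
  define s where "s = 1 / (K + 1)"
  have s: "0 < s" "K * s \<le> 1" using K0 by (auto simp: s_def field_simps)
  have Bs: "s *\<^sub>R axis j 1 \<in> B" for j
  proof -
    have "norm (q n *v (s *\<^sub>R axis j 1)) \<le> K * s" for n
      using s K0 bd[of n] by (intro order.trans[OF norm_matrix_vector_mult_le] mult_mono) (auto simp: q_def)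
    with s show ?thesis by (force simp: B_def intro: order_trans)
  qed
  define D where "D = {\<bar>det E\<bar> | E :: real^'n^'n. \<forall>j. column j E \<in> B}"
  have "\<bar>E$i$j\<bar> \<le> 1" if "\<forall>j. column j E \<in> B" for E :: "real^'n^'n" and i j
    using component_le_norm_cart[of "column j E" i] B1[of "column j E"] that
    by (fastforce simp: column_def)
  then have bdd: "bdd_above D"
    by (intro bdd_aboveI[of _ "real (card {p. p permutes (UNIV::'n set)})"])
       (auto simp: D_def intro!: abs_det_le_card)
  define M where "M = Sup D"
  have le_M: "\<bar>det E\<bar> \<le> M" if "\<forall>j. column j E \<in> B" for E
    unfolding M_def by (rule cSup_upper[OF _ bdd]) (use that in \<open>auto simp: D_def\<close>)
  have "column j (mat s) = s *\<^sub>R axis j 1" for j :: 'n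
    by (auto simp: column_def mat_def axis_def vec_eq_iff)
  then have sM: "\<forall>j. column j (mat s :: real^'n^'n) \<in> B" using Bs by simp
  have "det (mat s :: real^'n^'n) = s ^ CARD('n)" by (subst det_diagonal) (auto simp: mat_def)
  then have M0: "0 < M" using le_M[OF sM] zero_less_power[OF s(1), of "CARD('n)"] by linarith
  have "\<bar>det (mat s :: real^'n^'n)\<bar> \<in> D" using sM unfolding D_def by blast
  then have "D \<noteq> {}" by blast
  \<comment> \<open>Coming within a factor 2 of the supremum avoids showing that it is attained;
    this is the 2 in the bound.\<close>
  moreover have "M / 2 < Sup D" using M0 by (simp flip: M_def)
  ultimately obtain r where r: "r \<in> D" "M / 2 < r" using less_cSupE by blast
  then obtain E :: "real^'n^'n" where E: "\<forall>j. column j E \<in> B" "M / 2 < \<bar>det E\<bar>"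
    unfolding D_def by blast
  have "det E \<noteq> 0" using E(2) M0 by auto
  then obtain E' where E': "E ** E' = mat 1" "E' ** E = mat 1"
    using invertible_det_nz[of E] by (auto simp: invertible_def)
  \<comment> \<open>The matrix of \<open>Q\<close> in the basis formed by the columns of
    \<open>E\<close>, with the same trace.\<close>
  define C where "C = E' ** Q ** E"
  have EC: "E ** C = Q ** E" using E' by (simp add: C_def matrix_mul_assoc)
  have "\<bar>C$k$k\<bar> \<le> 2" for k
  proof -
    \<comment> \<open>\<open>E\<close> with column \<open>k\<close> replaced by
      \<open>Q *v column k E\<close>, again a vector of \<open>B\<close>; by Cramer its determinant
      is \<open>C$k$k * det E\<close>.\<close>
    let ?R = "(\<chi> i j. if j = k then (E *v column k C)$i else E$i$j) :: real^'n^'n"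
    have "column j ?R \<in> B" for j
    proof (cases "j = k")
      case True
      have "column k ?R = E *v column k C" by (simp add: column_def vec_eq_iff)
      also have "\<dots> = column k (E ** C)" by (rule column_mult[symmetric])
      also have "\<dots> = Q *v column k E" unfolding EC by (rule column_mult)
      finally show ?thesis using BQ E(1) True by simp
    next
      case False
      then have "column j ?R = column j E" by (simp add: column_def vec_eq_iff)
      then show ?thesis using E(1) by simp
    qed
    then have "\<bar>det ?R\<bar> \<le> M" by (intro le_M) auto
    moreover have "\<bar>det ?R\<bar> = \<bar>C$k$k\<bar> * \<bar>det E\<bar>" by (simp add: cramer_lemma column_def abs_mult)
    ultimately have "\<bar>C$k$k\<bar> * \<bar>det E\<bar> \<le> 2 * \<bar>det E\<bar>" using E(2) by linarith
    then show ?thesis using \<open>det E \<noteq> 0\<close> by (simp add: mult_le_cancel_right)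
  qed
  then have "(\<Sum>k\<in>UNIV. \<bar>C$k$k\<bar>) \<le> 2 * real CARD('n)"
    using sum_bounded_above[of UNIV "\<lambda>k. \<bar>C$k$k\<bar>" 2] by simp
  then have "\<bar>trace C\<bar> \<le> 2 * real CARD('n)"
    unfolding trace_def by (rule order_trans[OF sum_abs])
  moreover have "trace C = trace Q"
    using trace_mul_sym[of "E' ** Q" E] by (simp add: C_def matrix_mul_assoc E')
  ultimately show ?thesis by simp
qed

section \<open>Time-ordered products perturbed by matrix units\<close>

definition matrix_unit :: "'n \<Rightarrow> 'n \<Rightarrow> real^'n^'n" where
  "matrix_unit a b = (\<chi> i j. if i = a \<and> j = b then 1 else 0)"

text \<open>Later factors stand on the left. Within a cell the perturbation \<open>B k\<close> acts
  before the transition \<open>A k\<close>, matching a bump at the start of the cell.\<close>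

primrec step_product :: "(nat \<Rightarrow> real^'n^'n) \<Rightarrow> (nat \<Rightarrow> real^'n^'n) \<Rightarrow> nat \<Rightarrow> real^'n^'n" where
  "step_product A B 0 = mat 1"
| "step_product A B (Suc k) = A k ** B k ** step_product A B k"

text \<open>\<open>B 0\<close> is the rightmost factor of the whole product.\<close>

lemma step_product_change_first:
  assumes "0 < m"
  shows "step_product A (B(0 := R)) m = step_product A (B(0 := mat 1)) m ** R"
  using assms
proof (induction m)
  case (Suc m)
  then show ?case by (cases "m = 0") (simp_all add: matrix_mul_assoc)
qed simp

lemma step_product_cong:
  "(\<And>j. j < m \<Longrightarrow> A j = A' j \<and> B j = B' j) \<Longrightarrow> step_product A B m = step_product A' B' m"
  by (induction m) auto

text \<open>The product has rank one, column \<open>b\<close> of \<open>A\<close> times row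
  \<open>i\<close> of \<open>P\<close>; hence its entries factorise and nothing cancels inside
  them.\<close>

lemma matrix_unit_mult_entry:
  "(A ** (matrix_unit b i ** P)) $ k $ j = A $ k $ b * P $ i $ j"
proof -
  have "(matrix_unit b i ** P) $ l $ j = (if l = b then P $ i $ j else 0)" for l
    by (simp add: matrix_unit_def matrix_matrix_mult_def if_distrib[of "\<lambda>x. x * _"] cong: if_cong)
  then show ?thesis
    by (simp add: matrix_matrix_mult_def[of A] if_distrib[of "\<lambda>x. _ * x"] cong: if_cong)
qed

text \<open>\<open>x + d * y\<close> and \<open>x - d * y\<close> differ by
  \<open>2 * d * y\<close>, so they cannot both be small.\<close>

lemma exists_sign_large:
  fixes x y :: real assumes "0 \<le> d"
  obtains s where "\<bar>s\<bar> = d" "d * \<bar>y\<bar> \<le> \<bar>x + s * y\<bar>"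
proof -
  have *: "d * \<bar>y\<bar> = \<bar>d * y\<bar>" using assms by (simp add: abs_mult)
  have "\<bar>d * y\<bar> \<le> \<bar>x + d * y\<bar> \<or> \<bar>d * y\<bar> \<le> \<bar>x - d * y\<bar>" by arith
  then show thesis
  proof
    assume "\<bar>d * y\<bar> \<le> \<bar>x + d * y\<bar>"
    with * assms show thesis by (intro that[of d]) auto
  next
    assume "\<bar>d * y\<bar> \<le> \<bar>x - d * y\<bar>"
    with * assms show thesis by (intro that[of "- d"]) auto
  qed
qed

text \<open>Each sign is chosen such that the perturbation term and the unperturbed product do not
  cancel in one large entry; the perturbation of the first factor is saved for the trace.\<close>

lemma exists_perturbation_large_trace:
  fixes A :: "nat \<Rightarrow> real^'n^'n"
  assumes d: "0 < d" "d \<le> 1" and m: "0 < m"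
  obtains a b s where "\<And>j. \<bar>s j\<bar> \<le> d"
    "(\<Prod>j<m. d / (real CARD('n))\<^sup>2 * norm (A j)) \<le>
       \<bar>trace (step_product A (\<lambda>j. mat 1 + s j *\<^sub>R matrix_unit (a j) (b j)) m)\<bar>"
proof -
  define c where "c = (real CARD('n))\<^sup>2"
  have c: "1 \<le> c" by (simp add: c_def Suc_leI)
  define q where "q = d / c"
  have q0: "0 < q" using c d by (auto simp: q_def)
  have entry: "\<exists>i j. q * norm M \<le> d * \<bar>M$i$j\<bar>" for M :: "real^'n^'n"
  proof -
    obtain i j where "norm M \<le> c * \<bar>M$i$j\<bar>" unfolding c_def by (rule exists_large_entry)
    then have "d * norm M \<le> d * (c * \<bar>M$i$j\<bar>)" using d by (intro mult_left_mono) auto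
    then have "q * norm M \<le> d * \<bar>M$i$j\<bar>" using c by (simp add: q_def field_simps)
    then show ?thesis by blast
  qed
  let ?B = "\<lambda>a b s j. mat 1 + s j *\<^sub>R matrix_unit (a j) (b j)"
  \<comment> \<open>The left side carries \<open>m\<close> factors \<open>d\<close>, but with
    \<open>s 0 = 0\<close> only \<open>m - 1\<close> perturbations are spent. The extra
    \<open>d\<close> on the right balances this until the first factor is used for the
    trace.\<close>
  have "\<exists>a b s i j. s 0 = 0 \<and> (\<forall>j. \<bar>s j\<bar> \<le> d) \<and>
      (\<Prod>j<m. q * norm (A j)) \<le> d * \<bar>step_product A (?B a b s) m $ i $ j\<bar>"
    using m
  proof (induction m)
    case (Suc m)
    show ?case
    proof (cases "m = 0")
      case True
      obtain i j where "q * norm (A 0) \<le> d * \<bar>A 0 $ i $ j\<bar>" using entry by blast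
      with True d show ?thesis by (intro exI[of _ "\<lambda>_. i"] exI[of _ "\<lambda>_. 0::real"] exI[of _ i] exI[of _ j]) auto
    next
      case False
      with Suc.IH obtain a b s i j where IH: "s 0 = 0" "\<And>j. \<bar>s j\<bar> \<le> d"
        "(\<Prod>j<m. q * norm (A j)) \<le> d * \<bar>step_product A (?B a b s) m $ i $ j\<bar>" by blast
      define P where "P = step_product A (?B a b s) m"
      obtain k l where kl: "q * norm (A m) \<le> d * \<bar>A m $ k $ l\<bar>" using entry by blast
      obtain t where t: "\<bar>t\<bar> = d"
        "d * \<bar>A m $ k $ l * P $ i $ j\<bar> \<le> \<bar>(A m ** P) $ k $ j + t * (A m $ k $ l * P $ i $ j)\<bar>"
        using exists_sign_large[of d] d by (metis less_imp_le)
      \<comment> \<open>This matrix unit links the large entry \<open>(k, l)\<close> of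
        \<open>A m\<close> to the large entry \<open>(i, j)\<close> of \<open>P\<close>.\<close>
      let ?a = "a(m := l)" and ?b = "b(m := i)" and ?s = "s(m := t)"
      have "step_product A (?B ?a ?b ?s) m = P"
        unfolding P_def by (rule step_product_cong) auto
      then have "step_product A (?B ?a ?b ?s) (Suc m) = A m ** (mat 1 + t *\<^sub>R matrix_unit l i) ** P"
        by simp
      also have "\<dots> = A m ** P + t *\<^sub>R (A m ** (matrix_unit l i ** P))"
        by (simp add: bounded_bilinear.add_right[OF bounded_bilinear_matrix_matrix_mult]
            bounded_bilinear.add_left[OF bounded_bilinear_matrix_matrix_mult]
            bounded_bilinear.scaleR_right[OF bounded_bilinear_matrix_matrix_mult]
            bounded_bilinear.scaleR_left[OF bounded_bilinear_matrix_matrix_mult] matrix_mul_assoc)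
      finally have "step_product A (?B ?a ?b ?s) (Suc m) $ k $ j
          = (A m ** P) $ k $ j + t * (A m $ k $ l * P $ i $ j)"
        by (simp add: matrix_unit_mult_entry)
      then have "d * \<bar>A m $ k $ l\<bar> * \<bar>P $ i $ j\<bar> \<le> \<bar>step_product A (?B ?a ?b ?s) (Suc m) $ k $ j\<bar>"
        using t by (simp add: abs_mult mult_ac)
      moreover have "(\<Prod>j<Suc m. q * norm (A j)) \<le> (d * \<bar>P $ i $ j\<bar>) * (d * \<bar>A m $ k $ l\<bar>)"
        using IH(3) kl q0 d by (simp add: P_def mult_mono)
      ultimately have "(\<Prod>j<Suc m. q * norm (A j)) \<le> d * \<bar>step_product A (?B ?a ?b ?s) (Suc m) $ k $ j\<bar>"
        using mult_left_mono[of _ _ d] d by (smt (verit, best) mult.assoc mult.commute)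
      moreover have "?s 0 = 0" using IH False by simp
      moreover have "\<forall>j. \<bar>?s j\<bar> \<le> d" using IH t by simp
      ultimately show ?thesis by blast
    qed
  qed simp
  then obtain a b s i j where *: "s 0 = 0" "\<And>j. \<bar>s j\<bar> \<le> d"
      "(\<Prod>j<m. q * norm (A j)) \<le> d * \<bar>step_product A (?B a b s) m $ i $ j\<bar>" by blast
  define P where "P = step_product A (?B a b s) m"
  obtain t where t: "\<bar>t\<bar> = d" "d * \<bar>P $ i $ j\<bar> \<le> \<bar>trace P + t * P $ i $ j\<bar>"
    using exists_sign_large[of d] d by (metis less_imp_le)
  \<comment> \<open>Multiplying \<open>P\<close> on the right by \<open>matrix_unit j i\<close>
    moves the entry \<open>(i, j)\<close> onto the diagonal, so it becomes the trace.\<close>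
  let ?a = "a(0 := j)" and ?b = "b(0 := i)" and ?s = "s(0 := t)"
  have 1: "?B ?a ?b ?s = (?B a b s)(0 := mat 1 + t *\<^sub>R matrix_unit j i)"
    and 2: "?B a b s = (?B a b s)(0 := mat 1)" using *(1) by auto
  have "step_product A (?B ?a ?b ?s) m = P ** (mat 1 + t *\<^sub>R matrix_unit j i)"
    unfolding P_def 1 by (subst step_product_change_first[OF m]) (simp flip: 2)
  also have "\<dots> = P + t *\<^sub>R (P ** (matrix_unit j i ** mat 1))"
    by (simp add: bounded_bilinear.add_right[OF bounded_bilinear_matrix_matrix_mult]
        bounded_bilinear.scaleR_right[OF bounded_bilinear_matrix_matrix_mult])
  finally have "trace (step_product A (?B ?a ?b ?s) m) = trace P + t * P $ i $ j"
    by (simp add: trace_def sum.distrib matrix_unit_mult_entry mat_def if_distrib[of "\<lambda>x. _ * x"]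
        flip: sum_distrib_left cong: if_cong)
  then have "(\<Prod>j<m. q * norm (A j)) \<le> \<bar>trace (step_product A (?B ?a ?b ?s) m)\<bar>"
    using t *(3) by (simp add: P_def)
  moreover have "\<bar>?s j\<bar> \<le> d" for j using * t by simp
  ultimately show thesis using that[of ?s ?a ?b] by (simp add: q_def c_def)
qed

lemma norm_matrix_unit: "norm (matrix_unit a b) = 1"
proof -
  have "(norm (matrix_unit a b))\<^sup>2 = (\<Sum>i\<in>UNIV. \<Sum>j\<in>UNIV. if i = a then if j = b then 1 else 0 else 0)"
    unfolding norm_mat_sq by (intro sum.cong) (auto simp: matrix_unit_def)
  also have "\<dots> = (\<Sum>i\<in>UNIV. if i = a then 1 else 0)" by (intro sum.cong) auto
  finally have "(norm (matrix_unit a b))\<^sup>2 = 1\<^sup>2" by simp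
  then show ?thesis by (rule power2_eq_imp_eq) auto
qed

lemma matrix_unit_sq: "matrix_unit a b ** matrix_unit a b = (if a = b then 1 else 0) *\<^sub>R matrix_unit a b"
proof -
  have "(matrix_unit a b ** matrix_unit a b) $ k $ j = mat 1 $ k $ a * matrix_unit a b $ b $ j" for k j
    using matrix_unit_mult_entry[of "mat 1" a b "matrix_unit a b" k j] by simp
  then show ?thesis by (simp add: vec_eq_iff) (auto simp: matrix_unit_def mat_def)
qed

subsection \<open>Linear differential equations\<close>

lemma at_within_atLeast_eq:
  fixes t b :: real assumes "0 \<le> t" "t < b"
  shows "at t within {0..} = at t within {0..b}"
  by (rule at_within_nhd[of _ "{..<b}"]) (use assms in auto)

text \<open>The Peano-Baker series: \<open>P n\<close> is the \<open>n\<close>-fold iterated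
  integral, dominated by \<open>c * (L * t) ^ n / fact n\<close>. This gives convergence, termwise
  differentiation and the exponential bound at once.\<close>

lemma linear_ode_exists:
  fixes A :: "real \<Rightarrow> real^'n^'n"
  assumes cont: "continuous_on {0..} A" and bd: "\<And>t. 0 \<le> t \<Longrightarrow> norm (A t) \<le> L"
  obtains F where "F 0 = mat 1"
    "\<And>t. 0 \<le> t \<Longrightarrow> (F has_vector_derivative (A t ** F t)) (at t within {0..})"
    "\<And>t. 0 \<le> t \<Longrightarrow> norm (F t) \<le> norm (mat 1 :: real^'n^'n) * exp (L * t)"
proof -
  define c where "c = norm (mat 1 :: real^'n^'n)"
  have L0: "0 \<le> L" using bd[of 0] norm_ge_zero[of "A 0"] by linarith
  define P :: "nat \<Rightarrow> real \<Rightarrow> real^'n^'n" where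
    "P = rec_nat (\<lambda>t. mat 1) (\<lambda>n p t. integral {0..t} (\<lambda>s. A s ** p s))"
  have P0: "P 0 t = mat 1" for t by (simp add: P_def)
  have PS: "P (Suc n) t = integral {0..t} (\<lambda>s. A s ** P n s)" for n t by (simp add: P_def)
  have P00: "P (Suc n) 0 = 0" for n by (simp add: PS)
  \<comment> \<open>The derivative of \<open>P n\<close>; the index shift makes the differentiated
    series sum to \<open>A t ** F t\<close>.\<close>
  define D where "D n t = (case n of 0 \<Rightarrow> 0 | Suc k \<Rightarrow> A t ** P k t)" for n t
  have ftc: "((\<lambda>t. integral {0..t} f) has_vector_derivative f t) (at t within {0..})"
    if "continuous_on {0..} f" "0 \<le> t" for f :: "real \<Rightarrow> real^'n^'n" and t
  proof -
    have "((\<lambda>t. integral {0..t} f) has_vector_derivative f t) (at t within {0..t+1})"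
      by (rule integral_has_vector_derivative) (use that in \<open>auto intro: continuous_on_subset\<close>)
    then show ?thesis using at_within_atLeast_eq[of t "t+1"] that by simp
  qed
  have P: "continuous_on {0..} (P n) \<and>
      (\<forall>t\<ge>0. (P n has_vector_derivative D n t) (at t within {0..}))" for n
  proof (induction n)
    case 0
    have "P 0 = (\<lambda>t. mat 1)" by (auto simp: P0)
    then show ?case by (auto simp: D_def)
  next
    case (Suc n)
    have "continuous_on {0..} (\<lambda>s. A s ** P n s)"
      using Suc cont by (intro continuous_on_matrix_mult) auto
    then have d: "\<forall>t\<ge>0. (P (Suc n) has_vector_derivative D (Suc n) t) (at t within {0..})"
      using ftc[of "\<lambda>s. A s ** P n s"] by (auto simp: D_def PS[abs_def])
    then have "continuous_on {0..} (P (Suc n))"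
      by (auto simp: continuous_on_eq_continuous_within intro: has_vector_derivative_continuous)
    with d show ?case by simp
  qed
  have Pb: "norm (P n t) \<le> c * ((L * t) ^ n /\<^sub>R fact n)" if "0 \<le> t" for n t
    using that
  proof (induction n arbitrary: t)
    case 0
    then show ?case by (simp add: P0 c_def)
  next
    case (Suc n)
    show ?case
    proof (cases "t = 0")
      case False
      have "norm (P (Suc n) t - P (Suc n) 0) \<le>
        c * ((L * t) ^ Suc n /\<^sub>R fact (Suc n)) - c * ((L * 0) ^ Suc n /\<^sub>R fact (Suc n))"
      proof (rule differentiable_bound_general
          [where f' = "D (Suc n)" and \<phi>' = "\<lambda>s. c * L * ((L * s) ^ n /\<^sub>R fact n)"])
        show "0 < t" using Suc False by auto
        show "continuous_on {0..t} (P (Suc n))"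
          using P[of "Suc n"] by (auto elim!: continuous_on_subset)
        show "continuous_on {0..t} (\<lambda>s. c * ((L * s) ^ Suc n /\<^sub>R fact (Suc n)))"
          by (intro continuous_intros)
        fix s assume s: "0 < s" "s < t"
        have "at s within {0..} = at s" by (rule at_within_interior) (use s in auto)
        then show "(P (Suc n) has_vector_derivative D (Suc n) s) (at s)"
          using P[of "Suc n"] s by (metis less_eq_real_def)
        have "((\<lambda>s. c * ((L * s) ^ Suc n / fact (Suc n))) has_real_derivative
            (c * L * ((L * s) ^ n / fact n))) (at s)"
          by (rule derivative_eq_intros refl | simp)+
        then show "((\<lambda>s. c * ((L * s) ^ Suc n /\<^sub>R fact (Suc n))) has_vector_derivative
            c * L * ((L * s) ^ n /\<^sub>R fact n)) (at s)"
          by (simp add: has_real_derivative_iff_has_vector_derivative divide_inverse mult_ac)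
        have "norm (A s ** P n s) \<le> L * (c * ((L * s) ^ n /\<^sub>R fact n))"
          using s by (intro order.trans[OF norm_matrix_matrix_mult_le] mult_mono bd Suc L0) auto
        then show "norm (D (Suc n) s) \<le> c * L * ((L * s) ^ n /\<^sub>R fact n)"
          by (simp add: D_def mult_ac)
      qed
      then show ?thesis by (simp add: P00)
    qed (simp add: P00)
  qed
  have exps: "summable (\<lambda>n. x ^ n /\<^sub>R fact n)" for x :: real by (rule summable_exp_generic)
  have Psum: "summable (\<lambda>n. P n t)" if "0 \<le> t" for t
    by (rule summable_comparison_test[OF _ summable_mult[OF exps[of "L * t"], of c]])
       (use Pb that in auto)
  define F where "F t = (\<Sum>n. P n t)" for t
  have Fb: "norm (F t) \<le> c * exp (L * t)" if "0 \<le> t" for t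
  proof -
    have "norm (F t) \<le> (\<Sum>n. c * ((L * t) ^ n /\<^sub>R fact n))"
      unfolding F_def by (rule norm_suminf_le) (use Pb that summable_mult[OF exps] in auto)
    also have "\<dots> = c * exp (L * t)" by (simp only: suminf_mult[OF exps] exp_def)
    finally show ?thesis .
  qed
  have Dsum: "(\<lambda>n. D n t) sums (A t ** F t)" if "0 \<le> t" for t
  proof -
    have "(\<lambda>n. A t ** P n t) sums (A t ** F t)"
      unfolding F_def using bounded_linear.sums[OF bounded_bilinear.bounded_linear_right
          [OF bounded_bilinear_matrix_matrix_mult] summable_sums[OF Psum[OF that]]] .
    then show ?thesis using sums_Suc_iff[of "\<lambda>n. D n t" "A t ** F t"] by (simp add: D_def)
  qed
  have Fd: "(F has_vector_derivative (A t ** F t)) (at t within {0..})" if t: "0 \<le> t" for t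
  proof -
    \<comment> \<open>A compact interval for the Weierstrass test that extends beyond
      \<open>t\<close>, so that derivatives within it and within \<open>{0..}\<close> agree at
      \<open>t\<close>.\<close>
    define b where "b = t + 1"
    define M where "M n = (case n of 0 \<Rightarrow> 0 | Suc k \<Rightarrow> L * (c * ((L * b) ^ k /\<^sub>R fact k)))" for n
    have c0: "0 \<le> c" by (simp add: c_def)
    have "uniform_limit {0..b} (\<lambda>n x. \<Sum>i<n. D i x) (\<lambda>x. \<Sum>i. D i x) sequentially"
    proof (rule Weierstrass_m_test)
      fix n x assume x: "x \<in> {0..b}"
      show "norm (D n x) \<le> M n"
      proof (cases n)
        case (Suc k)
        have "norm (A x ** P k x) \<le> L * (c * ((L * x) ^ k /\<^sub>R fact k))"
          using x L0 by (intro order.trans[OF norm_matrix_matrix_mult_le] mult_mono bd Pb) auto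
        also have "\<dots> \<le> L * (c * ((L * b) ^ k /\<^sub>R fact k))"
          using x L0 c0 by (intro mult_left_mono scaleR_left_mono power_mono mult_nonneg_nonneg) auto
        finally show ?thesis by (simp add: Suc D_def M_def)
      qed (simp add: D_def M_def)
    next
      have "summable (\<lambda>n. M (Suc n))"
        using summable_mult[OF summable_mult[OF exps]] by (simp only: M_def nat.case)
      then show "summable M" by (simp add: summable_Suc_iff)
    qed
    then have ul: "\<forall>\<^sub>F n in sequentially. \<forall>x\<in>{0..b}. dist (\<Sum>i<n. D i x) (\<Sum>i. D i x) < e" if "e > 0" for e
      using that by (auto simp: uniform_limit_iff)
    have "\<exists>g. \<forall>x\<in>{0..b}. (\<lambda>n. P n x) sums g x \<and> (g has_derivative (\<lambda>h. h *\<^sub>R (A x ** F x))) (at x within {0..b})"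
    proof (rule has_derivative_series[where f' = "\<lambda>n x h. h *\<^sub>R D n x" and x = 0])
      fix n x assume "x \<in> {0..b}"
      then show "(P n has_derivative (\<lambda>h. h *\<^sub>R D n x)) (at x within {0..b})"
        using P[of n] has_vector_derivative_within_subset[of "P n" "D n x" x "{0..}" "{0..b}"]
        by (auto simp: has_vector_derivative_def)
    next
      fix e :: real assume "e > 0"
      from ul[OF this] show "\<forall>\<^sub>F n in sequentially. \<forall>x\<in>{0..b}. \<forall>h.
          norm ((\<Sum>i<n. h *\<^sub>R D i x) - h *\<^sub>R (A x ** F x)) \<le> e * norm h"
      proof eventually_elim
        case (elim n)
        show ?case
        proof (intro ballI allI)
          fix x h assume x: "x \<in> {0..b}"
          have "(\<Sum>i. D i x) = A x ** F x" using Dsum[of x] x by (simp add: sums_iff)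
          then have "norm ((\<Sum>i<n. D i x) - A x ** F x) \<le> e"
            using elim x by (metis dist_norm less_imp_le)
          then have "\<bar>h\<bar> * norm ((\<Sum>i<n. D i x) - A x ** F x) \<le> \<bar>h\<bar> * e" by (intro mult_left_mono) auto
          then show "norm ((\<Sum>i<n. h *\<^sub>R D i x) - h *\<^sub>R (A x ** F x)) \<le> e * norm h"
            by (simp add: mult.commute flip: scaleR_sum_right scaleR_diff_right)
        qed
      qed
    next
      show "0 \<in> {0..b}" using t by (simp add: b_def)
      show "(\<lambda>n. P n 0) sums F 0" unfolding F_def by (rule summable_sums[OF Psum]) simp
    qed simp
    then obtain g where g: "\<And>x. x \<in> {0..b} \<Longrightarrow> (\<lambda>n. P n x) sums g x"
      "\<And>x. x \<in> {0..b} \<Longrightarrow> (g has_vector_derivative (A x ** F x)) (at x within {0..b})"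
      unfolding has_vector_derivative_def by blast
    have "(F has_vector_derivative (A t ** F t)) (at t within {0..b})"
      by (rule has_vector_derivative_transform[OF _ _ g(2)])
         (use t g(1) in \<open>auto simp: b_def F_def sums_iff\<close>)
    then show ?thesis using at_within_atLeast_eq[of t b] t by (simp add: b_def)
  qed
  have "P n 0 = 0" if "n \<notin> {0}" for n using that P00 by (cases n) auto
  then have "(\<lambda>n. P n 0) sums (\<Sum>n\<in>{0}. P n 0)" by (intro sums_finite) auto
  then have "(\<lambda>n. P n 0) sums mat 1" by (simp add: P0)
  then have "F 0 = mat 1" by (simp add: F_def sums_iff)
  with Fd Fb that show ?thesis by (simp add: c_def)
qed

text \<open>Transpose of the solution for \<open>- transpose (A t)\<close>. \<open>G\<close> will
  turn out to be the inverse of \<open>F\<close>, with the same exponential bound.\<close>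

lemma linear_ode_adjoint_exists:
  fixes A :: "real \<Rightarrow> real^'n^'n"
  assumes cont: "continuous_on {0..} A" and bd: "\<And>t. 0 \<le> t \<Longrightarrow> norm (A t) \<le> L"
  obtains G where "G 0 = mat 1"
    "\<And>t. 0 \<le> t \<Longrightarrow> (G has_vector_derivative (- (G t ** A t))) (at t within {0..})"
    "\<And>t. 0 \<le> t \<Longrightarrow> norm (G t) \<le> norm (mat 1 :: real^'n^'n) * exp (L * t)"
proof -
  have "continuous_on {0..} (\<lambda>t. - transpose (A t))"
    by (intro continuous_on_minus bounded_linear.continuous_on[OF bounded_linear_transpose] cont)
  then obtain H where H: "H 0 = mat 1"
    "\<And>t. 0 \<le> t \<Longrightarrow> (H has_vector_derivative ((- transpose (A t)) ** H t)) (at t within {0..})"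
    "\<And>t. 0 \<le> t \<Longrightarrow> norm (H t) \<le> norm (mat 1 :: real^'n^'n) * exp (L * t)"
    using linear_ode_exists[of "\<lambda>t. - transpose (A t)" L] bd by (auto simp: norm_transpose)
  have tr: "transpose ((- transpose (A t)) ** H t) = - (transpose (H t) ** A t)" for t
    by (simp add: matrix_transpose_mul bounded_bilinear.minus_left[OF bounded_bilinear_matrix_matrix_mult]
        linear_neg[OF bounded_linear.linear[OF bounded_linear_transpose]])
  show ?thesis
  proof (rule that[of "\<lambda>t. transpose (H t)"])
    fix t :: real assume "0 \<le> t"
    from bounded_linear.has_vector_derivative[OF bounded_linear_transpose H(2)[OF this]]
    show "((\<lambda>t. transpose (H t)) has_vector_derivative (- (transpose (H t) ** A t))) (at t within {0..})"
      by (simp only: tr)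
  qed (use H in \<open>auto simp: norm_transpose transpose_mat\<close>)
qed

text \<open>The two terms of the product rule cancel. This one identity yields invertibility of
  solutions and their uniqueness.\<close>

lemma adjoint_mult_solution_constant:
  fixes A :: "real \<Rightarrow> real^'n^'n"
  assumes S: "convex S" "0 \<in> S" "t \<in> S"
    and G: "\<And>t. t \<in> S \<Longrightarrow> (G has_vector_derivative (- (G t ** A t))) (at t within S)"
    and F: "\<And>t. t \<in> S \<Longrightarrow> (F has_vector_derivative (A t ** F t)) (at t within S)"
  shows "G t ** F t = G 0 ** F 0"
proof -
  have "((\<lambda>t. G t ** F t) has_vector_derivative 0) (at t within S)" if "t \<in> S" for t
    using has_vector_derivative_matrix_mult[OF G[OF that] F[OF that]]
    by (simp add: matrix_mul_assoc bounded_bilinear.minus_left[OF bounded_bilinear_matrix_matrix_mult])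
  then have "((\<lambda>t. G t ** F t) has_derivative (\<lambda>h. 0)) (at t within S)" if "t \<in> S" for t
    using that by (simp add: has_vector_derivative_def)
  from has_derivative_zero_constant[OF S(1) this] S(2,3) show ?thesis by auto
qed

subsection \<open>Extension from closed curves\<close>

lemma Tietze_extension_real:
  fixes f :: "'a::metric_space \<Rightarrow> real"
  assumes "closed S" "continuous_on S f" "\<And>x. x \<in> S \<Longrightarrow> \<bar>f x\<bar> \<le> c" "0 \<le> c"
  obtains g where "continuous_on UNIV g" "\<And>x. x \<in> S \<Longrightarrow> g x = f x" "\<And>x. \<bar>g x\<bar> \<le> c"
proof -
  have "normal_space (euclidean :: 'a topology)"
    by (intro metrizable_imp_normal_space metrizable_space_euclidean)
  moreover have "closedin euclidean S" "continuous_map (subtopology euclidean S) euclideanreal f"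
    using assms by auto
  moreover have "f ` S \<subseteq> {-c..c}" using assms(3) by (force simp: abs_le_iff)
  ultimately obtain g where g: "continuous_map euclidean euclideanreal g" "\<And>x. x \<in> S \<Longrightarrow> g x = f x"
    "g ` topspace euclidean \<subseteq> {-c..c}"
    using Tietze_extension_closed_real_interval[of euclidean S f "-c" c] assms(4) by auto
  show thesis
  proof (rule that[of g])
    show "\<bar>g x\<bar> \<le> c" for x using g(3) by (auto simp: abs_le_iff image_subset_iff minus_le_iff)
  qed (use g in auto)
qed

text \<open>The curve is a quotient map onto its image since its domain is compact.\<close>

lemma extend_from_closed_curve_real:
  fixes \<gamma> :: "real \<Rightarrow> 'a::metric_space" and f :: "real \<Rightarrow> real"
  assumes \<gamma>: "continuous_on {0..p} \<gamma>" and f: "continuous_on {0..p} f"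
    and resp: "\<And>s t. s \<in> {0..p} \<Longrightarrow> t \<in> {0..p} \<Longrightarrow> \<gamma> s = \<gamma> t \<Longrightarrow> f s = f t"
    and bd: "\<And>t. t \<in> {0..p} \<Longrightarrow> \<bar>f t\<bar> \<le> c" and c: "0 \<le> c"
  obtains g where "continuous_on UNIV g" "\<And>t. t \<in> {0..p} \<Longrightarrow> g (\<gamma> t) = f t" "\<And>x. \<bar>g x\<bar> \<le> c"
proof -
  let ?O = "\<gamma> ` {0..p}"
  define f0 where "f0 y = f (inv_into {0..p} \<gamma> y)" for y
  have f0: "f0 (\<gamma> t) = f t" if "t \<in> {0..p}" for t
    unfolding f0_def using that by (intro resp f_inv_into_f inv_into_into) auto
  have cl: "closed ?O" by (intro compact_imp_closed compact_continuous_image \<gamma> compact_Icc)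
  have "continuous_on ?O f0"
    unfolding continuous_on_closed_vimage[OF cl]
  proof (intro allI impI)
    fix T :: "real set" assume T: "closed T"
    have "f0 -` T \<inter> ?O = \<gamma> ` ({0..p} \<inter> f -` T)" using f0 by auto
    moreover have "closed ({0..p} \<inter> f -` T)" using f T by (simp add: continuous_closed_preimage)
    then have "compact ({0..p} \<inter> f -` T)" by (metis compact_Icc compact_Int_closed inf.left_idem)
    then have "compact (\<gamma> ` ({0..p} \<inter> f -` T))"
      by (intro compact_continuous_image continuous_on_subset[OF \<gamma>]) auto
    ultimately show "closed (f0 -` T \<inter> ?O)" by (simp add: compact_imp_closed)
  qed
  moreover have "\<bar>f0 x\<bar> \<le> c" if "x \<in> ?O" for x using that f0 bd by auto
  ultimately obtain g where "continuous_on UNIV g" "\<And>x. x \<in> ?O \<Longrightarrow> g x = f0 x" "\<And>x. \<bar>g x\<bar> \<le> c"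
    using Tietze_extension_real[OF cl _ _ c] by metis
  with f0 show thesis by (intro that[of g]) auto
qed

text \<open>Scalar extension of every entry; passing from entries back to the Frobenius norm costs
  the square of the dimension.\<close>

lemma extend_from_closed_curve_matrix:
  fixes \<gamma> :: "real \<Rightarrow> 'a::metric_space" and f :: "real \<Rightarrow> real^'n^'n"
  assumes \<gamma>: "continuous_on {0..p} \<gamma>" and f: "continuous_on {0..p} f"
    and resp: "\<And>s t. s \<in> {0..p} \<Longrightarrow> t \<in> {0..p} \<Longrightarrow> \<gamma> s = \<gamma> t \<Longrightarrow> f s = f t"
    and bd: "\<And>t. t \<in> {0..p} \<Longrightarrow> norm (f t) \<le> c" and c: "0 \<le> c"
  obtains g where "continuous_on UNIV g" "\<And>t. t \<in> {0..p} \<Longrightarrow> g (\<gamma> t) = f t"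
    "\<And>x. norm (g x) \<le> (real CARD('n))\<^sup>2 * c"
proof -
  have "\<exists>g. continuous_on UNIV g \<and> (\<forall>t\<in>{0..p}. g (\<gamma> t) = f t $ i $ j) \<and> (\<forall>x. \<bar>g x\<bar> \<le> c)" for i j
  proof -
    have "continuous_on {0..p} (\<lambda>t. f t $ i $ j)" by (intro continuous_intros f)
    moreover have "\<bar>f t $ i $ j\<bar> \<le> c" if "t \<in> {0..p}" for t
      using bd[OF that] abs_entry_le_norm order_trans by blast
    ultimately show ?thesis
      using extend_from_closed_curve_real[OF \<gamma>, of "\<lambda>t. f t $ i $ j" c] resp c by metis
  qed
  then obtain g where g: "\<And>i j. continuous_on UNIV (g i j)"
    "\<And>i j t. t \<in> {0..p} \<Longrightarrow> g i j (\<gamma> t) = f t $ i $ j" "\<And>i j x. \<bar>g i j x\<bar> \<le> c" by metis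
  show thesis
  proof (rule that[of "\<lambda>x. \<chi> i j. g i j x"])
    show "continuous_on UNIV (\<lambda>x. \<chi> i j. g i j x)" by (intro continuous_on_vec_lambda g)
    show "norm (\<chi> i j. g i j x) \<le> (real CARD('n))\<^sup>2 * c" for x
      by (rule norm_matrix_le_card) (simp add: g)
  qed (use g in \<open>auto simp: vec_eq_iff\<close>)
qed

subsection \<open>Linear equations over a semiflow\<close>

lemma sum_shift_nat:
  fixes f :: "nat \<Rightarrow> real"
  shows "(\<Sum>k<n. f (i + k)) = (\<Sum>k<i + n. f k) - (\<Sum>k<i. f k)"
  by (induction n) auto

text \<open>The cubic smoothstep and its derivative \<open>6 * x * (1 - x)\<close>, cut off at 0.
  The derivative vanishes at 0 and 1, so bumps built from it are continuous when extended by
  zero.\<close>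

definition ramp :: "real \<Rightarrow> real" where "ramp x = 3 * x\<^sup>2 - 2 * x^3"
definition ramp_rate :: "real \<Rightarrow> real" where "ramp_rate x = max 0 (6 * x * (1 - x))"

lemma ramp_0: "ramp 0 = 0" and ramp_1: "ramp 1 = 1" by (auto simp: ramp_def)

lemma ramp_deriv:
  assumes "0 \<le> x" "x \<le> 1"
  shows "(ramp has_real_derivative ramp_rate x) (at x within S)"
proof -
  have "(ramp has_real_derivative (6 * x - 6 * x\<^sup>2)) (at x within S)"
    unfolding ramp_def[abs_def] by (rule derivative_eq_intros refl | simp)+
  moreover have "ramp_rate x = 6 * x - 6 * x\<^sup>2"
    using assms by (simp add: ramp_rate_def max_def power2_eq_square algebra_simps mult_left_le)
  ultimately show ?thesis by simp
qed

lemma ramp_bounds: "0 \<le> x \<Longrightarrow> x \<le> 1 \<Longrightarrow> 0 \<le> ramp x \<and> ramp x \<le> 1"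
proof -
  assume x: "0 \<le> x" "x \<le> 1"
  have "ramp x = x\<^sup>2 * (3 - 2 * x)" "1 - ramp x = (1 - x)\<^sup>2 * (1 + 2 * x)"
    by (simp_all add: ramp_def power2_eq_square power3_eq_cube algebra_simps)
  moreover have "0 \<le> x\<^sup>2 * (3 - 2 * x)" "0 \<le> (1 - x)\<^sup>2 * (1 + 2 * x)" using x by auto
  ultimately show ?thesis by linarith
qed

lemma ramp_rate_outside: "x \<le> 0 \<or> 1 \<le> x \<Longrightarrow> ramp_rate x = 0"
  using mult_nonpos_nonneg[of x "1 - x"] mult_nonneg_nonpos[of x "1 - x"]
  by (auto simp: ramp_rate_def mult.assoc)

lemma ramp_rate_bounds: "0 \<le> ramp_rate x" "ramp_rate x \<le> 3 / 2"
proof -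
  have "0 \<le> (2 * x - 1)\<^sup>2" by simp
  then have "6 * x * (1 - x) \<le> 3 / 2" by (simp add: power2_eq_square algebra_simps)
  then show "0 \<le> ramp_rate x" "ramp_rate x \<le> 3 / 2" by (auto simp: ramp_rate_def)
qed

text \<open>\<open>X\<close> is a parameter because the general facts are applied both to the given
  coefficient and to its perturbation \<open>Y\<close> over the same semiflow.\<close>

locale linear_skew_product =
  fixes W :: "'w::metric_space set" and \<phi> :: "real \<Rightarrow> 'w \<Rightarrow> 'w" and X :: "'w \<Rightarrow> real^'n^'n"
  assumes compact_W: "compact W" and semiflow: "continuous_semiflow_on W \<phi>"
    and cont_X: "continuous_on W X"
begin

lemma flow_in: "0 \<le> t \<Longrightarrow> w \<in> W \<Longrightarrow> \<phi> t w \<in> W"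
  and flow_0: "w \<in> W \<Longrightarrow> \<phi> 0 w = w"
  and flow_add: "0 \<le> s \<Longrightarrow> 0 \<le> t \<Longrightarrow> w \<in> W \<Longrightarrow> \<phi> (s + t) w = \<phi> s (\<phi> t w)"
  and cont_flow: "continuous_on ({0..} \<times> W) (\<lambda>(t, w). \<phi> t w)"
  using semiflow by (auto simp: continuous_semiflow_on_def)

lemma cont_orbit: "w \<in> W \<Longrightarrow> continuous_on {0..} (\<lambda>t. \<phi> t w)"
  by (rule continuous_on_compose2[OF cont_flow, of "{0..}" "\<lambda>t. (t, w)", simplified])
     (auto intro!: continuous_intros)

lemma cont_coeff: "w \<in> W \<Longrightarrow> continuous_on {0..} (\<lambda>t. X (\<phi> t w))"
  by (rule continuous_on_compose2[OF cont_X cont_orbit]) (auto simp: flow_in)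

text \<open>A choice instead of a supremum gives a nonnegative value without a separate case for
  empty \<open>W\<close>.\<close>

definition bound :: real where
  "bound = (SOME L. 0 \<le> L \<and> (\<forall>w\<in>W. norm (X w) \<le> L))"

lemma bound_nonneg: "0 \<le> bound" and norm_X_le: "w \<in> W \<Longrightarrow> norm (X w) \<le> bound"
proof -
  have "bounded (X ` W)"
    by (intro compact_imp_bounded compact_continuous_image cont_X compact_W)
  then obtain L where "\<forall>w\<in>W. norm (X w) \<le> L" by (auto simp: bounded_iff)
  then have "0 \<le> max 0 L \<and> (\<forall>w\<in>W. norm (X w) \<le> max 0 L)" by auto
  then have "0 \<le> bound \<and> (\<forall>w\<in>W. norm (X w) \<le> bound)" unfolding bound_def by (rule someI)
  then show "0 \<le> bound" "w \<in> W \<Longrightarrow> norm (X w) \<le> bound" by auto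
qed

abbreviation fm :: "real \<Rightarrow> 'w \<Rightarrow> real^'n^'n" where "fm \<equiv> fundamental_matrix \<phi> X"

text \<open>Common bound for the fundamental matrix and its inverse. \<open>growth 0\<close> is the
  Frobenius norm of the identity, not 1.\<close>

definition growth :: "real \<Rightarrow> real" where
  "growth t = norm (mat 1 :: real^'n^'n) * exp (bound * t)"

text \<open>\<open>G\<close> is a left inverse of every fundamental solution, and a right inverse of
  \<open>F\<close> because matrices are square. Any solution \<open>H\<close> then equals
  \<open>F ** G ** H = F\<close> on nonnegative times, which justifies the definite
  description.\<close>

lemma fm_exists:
  assumes w: "w \<in> W"
  obtains F G where "F 0 = mat 1" "G 0 = mat 1"
    "\<And>t. 0 \<le> t \<Longrightarrow> (F has_vector_derivative (X (\<phi> t w) ** F t)) (at t within {0..})"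
    "\<And>t. 0 \<le> t \<Longrightarrow> (G has_vector_derivative (- (G t ** X (\<phi> t w)))) (at t within {0..})"
    "\<And>t. 0 \<le> t \<Longrightarrow> G t ** F t = mat 1" "\<And>t. 0 \<le> t \<Longrightarrow> F t ** G t = mat 1"
    "\<And>t. 0 \<le> t \<Longrightarrow> norm (F t) \<le> growth t" "\<And>t. 0 \<le> t \<Longrightarrow> norm (G t) \<le> growth t"
    "\<And>t. 0 \<le> t \<Longrightarrow> fm t w = F t"
proof -
  let ?A = "\<lambda>t. X (\<phi> t w)"
  have bd: "norm (?A t) \<le> bound" if "0 \<le> t" for t using norm_X_le flow_in w that by auto
  obtain F where F: "F 0 = mat 1"
    "\<And>t. 0 \<le> t \<Longrightarrow> (F has_vector_derivative (?A t ** F t)) (at t within {0..})"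
    "\<And>t. 0 \<le> t \<Longrightarrow> norm (F t) \<le> norm (mat 1 :: real^'n^'n) * exp (bound * t)"
    using linear_ode_exists[OF cont_coeff[OF w] bd] by blast
  obtain G where G: "G 0 = mat 1"
    "\<And>t. 0 \<le> t \<Longrightarrow> (G has_vector_derivative (- (G t ** ?A t))) (at t within {0..})"
    "\<And>t. 0 \<le> t \<Longrightarrow> norm (G t) \<le> norm (mat 1 :: real^'n^'n) * exp (bound * t)"
    using linear_ode_adjoint_exists[OF cont_coeff[OF w] bd] by blast
  have GH: "G t ** H t = mat 1" if "is_fundamental_solution \<phi> X w H" "0 \<le> t" for H t
    using adjoint_mult_solution_constant[of "{0..}" t G ?A H] G that
    by (auto simp: is_fundamental_solution_def)
  have isF: "is_fundamental_solution \<phi> X w F" using F by (simp add: is_fundamental_solution_def)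
  have FG: "F t ** G t = mat 1" if "0 \<le> t" for t
    using GH[OF isF that] matrix_left_right_inverse by blast
  have "fm t w = F t" if "0 \<le> t" for t
    unfolding fundamental_matrix_def
  proof (rule the_equality)
    fix M assume "\<exists>H. is_fundamental_solution \<phi> X w H \<and> H t = M"
    then obtain H where H: "is_fundamental_solution \<phi> X w H" "H t = M" by blast
    have "M = (F t ** G t) ** H t" using FG[OF that] H by simp
    also have "\<dots> = F t" using GH[OF H(1) that] by (simp flip: matrix_mul_assoc)
    finally show "M = F t" .
  qed (use isF in blast)
  with F G FG GH[OF isF] show ?thesis by (intro that[of F G]) (auto simp: growth_def)
qed

definition fmi :: "real \<Rightarrow> 'w \<Rightarrow> real^'n^'n" where "fmi t w = matrix_inv (fm t w)"

lemma fm_props: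
  assumes w: "w \<in> W"
  shows fm_0: "fm 0 w = mat 1"
    and fm_deriv: "\<And>t. 0 \<le> t \<Longrightarrow> ((\<lambda>t. fm t w) has_vector_derivative (X (\<phi> t w) ** fm t w)) (at t within {0..})"
    and fmi_0: "fmi 0 w = mat 1"
    and fmi_deriv: "\<And>t. 0 \<le> t \<Longrightarrow> ((\<lambda>t. fmi t w) has_vector_derivative (- (fmi t w ** X (\<phi> t w)))) (at t within {0..})"
    and fmi_fm: "\<And>t. 0 \<le> t \<Longrightarrow> fmi t w ** fm t w = mat 1"
    and fm_fmi: "\<And>t. 0 \<le> t \<Longrightarrow> fm t w ** fmi t w = mat 1"
    and norm_fm_le: "\<And>t. 0 \<le> t \<Longrightarrow> norm (fm t w) \<le> growth t"
    and norm_fmi_le: "\<And>t. 0 \<le> t \<Longrightarrow> norm (fmi t w) \<le> growth t"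
proof -
  obtain F G where *: "F 0 = mat 1" "G 0 = mat 1"
    "\<And>t. 0 \<le> t \<Longrightarrow> (F has_vector_derivative (X (\<phi> t w) ** F t)) (at t within {0..})"
    "\<And>t. 0 \<le> t \<Longrightarrow> (G has_vector_derivative (- (G t ** X (\<phi> t w)))) (at t within {0..})"
    "\<And>t. 0 \<le> t \<Longrightarrow> G t ** F t = mat 1" "\<And>t. 0 \<le> t \<Longrightarrow> F t ** G t = mat 1"
    "\<And>t. 0 \<le> t \<Longrightarrow> norm (F t) \<le> growth t" "\<And>t. 0 \<le> t \<Longrightarrow> norm (G t) \<le> growth t"
    "\<And>t. 0 \<le> t \<Longrightarrow> fm t w = F t"
    using fm_exists[OF w] by blast
  have fmi: "fmi t w = G t" if "0 \<le> t" for t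
    using * that by (auto simp: fmi_def intro!: matrix_inv_eqI)
  have 1: "((\<lambda>t. fm t w) has_vector_derivative (X (\<phi> t w) ** F t)) (at t within {0..})" if "0 \<le> t" for t
    by (rule has_vector_derivative_transform[OF _ _ *(3)]) (use that * in auto)
  have 2: "((\<lambda>t. fmi t w) has_vector_derivative (- (G t ** X (\<phi> t w)))) (at t within {0..})" if "0 \<le> t" for t
    by (rule has_vector_derivative_transform[OF _ _ *(4)]) (use that fmi in auto)
  show "fm 0 w = mat 1" "fmi 0 w = mat 1" using * fmi by auto
  fix t :: real assume t: "0 \<le> t"
  show "((\<lambda>t. fm t w) has_vector_derivative (X (\<phi> t w) ** fm t w)) (at t within {0..})"
    using 1 * t by simp
  show "((\<lambda>t. fmi t w) has_vector_derivative (- (fmi t w ** X (\<phi> t w)))) (at t within {0..})"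
    using 2 fmi t by simp
  show "fmi t w ** fm t w = mat 1" "fm t w ** fmi t w = mat 1" "norm (fm t w) \<le> growth t" "norm (fmi t w) \<le> growth t"
    using * fmi t by auto
qed

text \<open>\<open>fmi t w ** H t\<close> is constant. A finite horizon \<open>b\<close> is needed
  because explicit solutions of the perturbed equation are known only on one cell at a time.\<close>

lemma fm_unique:
  assumes w: "w \<in> W" and t: "0 \<le> t" "t \<le> b" and H0: "H 0 = mat 1"
    and H: "\<And>s. 0 \<le> s \<Longrightarrow> s \<le> b \<Longrightarrow> (H has_vector_derivative (X (\<phi> s w) ** H s)) (at s within {0..b})"
  shows "fm t w = H t"
proof -
  have "fmi t w ** H t = fmi 0 w ** H 0"
    by (rule adjoint_mult_solution_constant[of "{0..b}" _ "\<lambda>t. fmi t w" "\<lambda>s. X (\<phi> s w)"])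
       (use t H in \<open>auto intro: has_vector_derivative_within_subset[OF fmi_deriv[OF w]]\<close>)
  then have "fmi t w ** H t = mat 1" by (simp add: fmi_0 w H0)
  then have "fm t w ** (fmi t w ** H t) = fm t w" by simp
  then show ?thesis using fm_fmi[OF w t(1)] by (simp add: matrix_mul_assoc)
qed

text \<open>The cocycle property, by uniqueness: \<open>fm (s + t) w ** fmi t w\<close> as a
  function of \<open>s\<close> solves the equation started at \<open>\<phi> t w\<close>.\<close>

lemma fm_add:
  assumes w: "w \<in> W" and "0 \<le> s" "0 \<le> t"
  shows "fm (s + t) w = fm s (\<phi> t w) ** fm t w"
proof -
  have "fm s (\<phi> t w) = fm (s + t) w ** fmi t w"
  proof (rule fm_unique[where b = s])
    show "fm (0 + t) w ** fmi t w = mat 1" using fm_fmi assms by simp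
    fix r assume r: "0 \<le> r" "r \<le> s"
    have "((\<lambda>r. fm (r + t) w) has_vector_derivative (X (\<phi> (r + t) w) ** fm (r + t) w)) (at r within {0..s})"
    proof -
      have "((\<lambda>t. fm t w) has_vector_derivative (X (\<phi> (r + t) w) ** fm (r + t) w)) (at (r + t) within (\<lambda>r. r + t) ` {0..s})"
        by (rule has_vector_derivative_within_subset[OF fm_deriv[OF w]]) (use r assms in auto)
      moreover have "((\<lambda>r. r + t) has_vector_derivative 1) (at r within {0..s})"
        by (rule derivative_eq_intros refl | simp)+
      ultimately show ?thesis
        using vector_diff_chain_within[of "\<lambda>r. r + t" 1 r "{0..s}" "\<lambda>t. fm t w"] by (simp add: o_def)
    qed
    from has_vector_derivative_matrix_mult[OF this has_vector_derivative_const[of "fmi t w"]]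
    show "((\<lambda>r. fm (r + t) w ** fmi t w) has_vector_derivative
        X (\<phi> r (\<phi> t w)) ** (fm (r + t) w ** fmi t w)) (at r within {0..s})"
      using r assms by (simp add: flow_add matrix_mul_assoc)
  qed (use assms flow_in in auto)
  then show ?thesis using fmi_fm[OF w] assms by (simp flip: matrix_mul_assoc)
qed

lemma cont_fm: "w \<in> W \<Longrightarrow> continuous_on {0..} (\<lambda>t. fm t w)"
  and cont_fmi: "w \<in> W \<Longrightarrow> continuous_on {0..} (\<lambda>t. fmi t w)"
  by (auto simp: continuous_on_eq_continuous_within
      intro: has_vector_derivative_continuous fm_deriv fmi_deriv)

lemma growth_pos: "0 < growth t"
proof -
  have "(mat 1 :: real^'n^'n) \<noteq> 0" by (auto simp: vec_eq_iff mat_def)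
  then show ?thesis by (simp add: growth_def)
qed

lemma growth_mono: "s \<le> t \<Longrightarrow> growth s \<le> growth t"
  by (auto simp: growth_def bound_nonneg intro!: mult_left_mono)

text \<open>Invertibility; it keeps all logarithms below away from \<open>ln 0\<close>.\<close>

lemma fm_nonzero: "w \<in> W \<Longrightarrow> 0 \<le> t \<Longrightarrow> fm t w \<noteq> 0"
  using fm_fmi[of w t] growth_pos[of 0]
  by (auto simp: growth_def bounded_bilinear.zero_left[OF bounded_bilinear_matrix_matrix_mult])

text \<open>Variation of constants: \<open>fmi t v ** fm t w\<close> has derivative
  \<open>fmi t v ** (X (\<phi> t w) - X (\<phi> t v)) ** fm t w\<close>.\<close>

lemma cont_fm_point:
  assumes "0 \<le> b"
  shows "continuous_on W (fm b)"
  unfolding continuous_on_iff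
proof (intro ballI allI impI)
  fix v and e :: real assume v: "v \<in> W" and e: "0 < e"
  let ?A = "\<lambda>s w. X (\<phi> s w)"
  have "continuous_on ({0..b} \<times> W) (\<lambda>(s, w). ?A s w)"
    unfolding case_prod_unfold
    by (rule continuous_on_compose2[OF cont_X
          continuous_on_subset[OF cont_flow[unfolded case_prod_unfold]]])
       (auto simp: flow_in)
  then have uc: "uniformly_continuous_on ({0..b} \<times> W) (\<lambda>(s, w). ?A s w)"
    by (rule compact_uniformly_continuous) (intro compact_Times compact_W compact_Icc)
  \<comment> \<open>The \<open>+ 1\<close> makes \<open>c\<close> positive and the final estimate
    \<open>k * (c - 1) < e\<close> strict.\<close>
  define c where "c = growth b * (growth b * growth b * b) + 1"
  have c: "0 < c" using growth_pos[of b] assms by (auto simp: c_def intro!: add_nonneg_pos)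
  define k where "k = e / c"
  have k: "0 < k" using e c by (simp add: k_def)
  obtain d where d: "d > 0" "\<And>x y. x \<in> {0..b} \<times> W \<Longrightarrow> y \<in> {0..b} \<times> W \<Longrightarrow> dist y x < d \<Longrightarrow>
      dist (case y of (s, w) \<Rightarrow> ?A s w) (case x of (s, w) \<Rightarrow> ?A s w) < k"
    using uc k unfolding uniformly_continuous_on_def by blast
  show "\<exists>d>0. \<forall>w\<in>W. dist w v < d \<longrightarrow> dist (fm b w) (fm b v) < e"
  proof (intro exI[of _ d] conjI ballI impI)
    fix w assume w: "w \<in> W" "dist w v < d"
    let ?H = "\<lambda>t. fmi t v ** fm t w"
    have Hd: "(?H has_vector_derivative (fmi t v ** ((?A t w - ?A t v) ** fm t w))) (at t within {0..b})"
      if "t \<in> {0..b}" for t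
      using has_vector_derivative_within_subset[OF has_vector_derivative_matrix_mult
          [OF fmi_deriv[OF v] fm_deriv[OF w(1)]], of t "{0..b}"] that
      by (simp add: bounded_bilinear.minus_left[OF bounded_bilinear_matrix_matrix_mult]
          bounded_bilinear.diff_left[OF bounded_bilinear_matrix_matrix_mult]
          bounded_bilinear.diff_right[OF bounded_bilinear_matrix_matrix_mult] matrix_mul_assoc)
    have bd: "norm (fmi t v ** ((?A t w - ?A t v) ** fm t w)) \<le> growth b * (k * growth b)"
      if t: "t \<in> {0..b}" for t
    proof -
      have "norm (?A t w - ?A t v) \<le> k"
        using d(2)[of "(t, v)" "(t, w)"] w v t by (simp add: dist_norm dist_Pair_Pair)
      moreover have "norm (fmi t v) \<le> growth b" "norm (fm t w) \<le> growth b"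
        using norm_fmi_le[OF v, of t] norm_fm_le[OF w(1), of t] growth_mono[of t b] t by auto
      ultimately have "norm (fmi t v) * (norm (?A t w - ?A t v) * norm (fm t w)) \<le> growth b * (k * growth b)"
        using growth_pos[of b] k by (intro mult_mono) (auto simp: mult_nonneg_nonneg less_imp_le)
      then show ?thesis
        by (meson norm_matrix_matrix_mult_le mult_left_mono norm_ge_zero order_trans)
    qed
    have "norm (?H b - ?H 0) \<le> (growth b * (k * growth b)) * norm (b - 0)"
    proof (rule differentiable_bound[where S = "{0..b}"])
      show "(?H has_derivative (\<lambda>h. h *\<^sub>R (fmi t v ** ((?A t w - ?A t v) ** fm t w)))) (at t within {0..b})"
        if "t \<in> {0..b}" for t using Hd[OF that] by (simp add: has_vector_derivative_def)
      show "onorm (\<lambda>h. h *\<^sub>R (fmi t v ** ((?A t w - ?A t v) ** fm t w))) \<le> growth b * (k * growth b)"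
        if "t \<in> {0..b}" for t
        by (rule onorm_le) (use bd[OF that] in \<open>simp add: mult.commute mult_left_mono\<close>)
    qed (use assms in auto)
    then have H: "norm (?H b - mat 1) \<le> growth b * (k * growth b) * b"
      using assms v w fm_0 fmi_0 by simp
    have "fm b w - fm b v = fm b v ** (?H b - mat 1)"
      using fm_fmi[OF v assms]
      by (simp add: bounded_bilinear.diff_right[OF bounded_bilinear_matrix_matrix_mult] matrix_mul_assoc)
    then have "norm (fm b w - fm b v) \<le> norm (fm b v) * norm (?H b - mat 1)"
      by (simp add: norm_matrix_matrix_mult_le)
    also have "\<dots> \<le> growth b * (growth b * (k * growth b) * b)"
      using H norm_fm_le[OF v assms] growth_pos[of b] by (intro mult_mono) auto
    also have "\<dots> = k * (c - 1)" by (simp add: c_def)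
    also have "\<dots> < e" using k c by (simp add: k_def field_simps e)
    finally show "dist (fm b w) (fm b v) < e" by (simp add: dist_norm)
  qed (use d in auto)
qed

section \<open>Periodic orbits\<close>

lemma flow_multiple_period:
  assumes w: "w \<in> W" and p: "0 \<le> p" "\<phi> p w = w"
  shows "\<phi> (real n * p) w = w"
proof (induction n)
  case (Suc n)
  have "\<phi> (p + real n * p) w = \<phi> p (\<phi> (real n * p) w)" using p w by (intro flow_add) auto
  then show ?case using Suc p by (simp add: algebra_simps)
qed (simp add: flow_0 w)

lemma fm_multiple_period:
  assumes w: "w \<in> W" and p: "0 \<le> p" "\<phi> p w = w"
  shows "fm (real n * p) w = ((**) (fm p w) ^^ n) (mat 1)"
proof (induction n)
  case (Suc n)
  have "fm (p + real n * p) w = fm p (\<phi> (real n * p) w) ** fm (real n * p) w"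
    using p w by (intro fm_add) auto
  then show ?case using Suc flow_multiple_period[OF assms] by (simp add: algebra_simps)
qed (simp add: fm_0 w)

text \<open>A semiflow runs only forward, so both points are moved on by \<open>p - t\<close>: this
  yields the return time \<open>p - t + s\<close>, which is below \<open>p\<close> and positive
  unless \<open>s = 0\<close> and \<open>t = p\<close>.\<close>

lemma orbit_injective:
  assumes w: "w \<in> W" and p: "\<phi> p w = w" and min: "\<And>r. 0 < r \<Longrightarrow> r < p \<Longrightarrow> \<phi> r w \<noteq> w"
    and st: "0 \<le> s" "s < t" "t \<le> p" and eq: "\<phi> s w = \<phi> t w"
  shows "s = 0 \<and> t = p"
proof (rule ccontr)
  assume "\<not> ?thesis"
  then have "0 < p - t + s" "p - t + s < p" using st by auto
  then have "\<phi> (p - t + s) w \<noteq> w" by (rule min)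
  moreover have "\<phi> (p - t + s) w = \<phi> (p - t) (\<phi> s w)" using st w by (intro flow_add) auto
  moreover have "\<phi> (p - t + t) w = \<phi> (p - t) (\<phi> t w)" using st w by (intro flow_add) auto
  ultimately show False using eq p by simp
qed

subsection \<open>Perturbation along a long periodic orbit\<close>

text \<open>Since \<open>E ** E\<close> is \<open>E\<close> or \<open>0\<close> for \<open>E = matrix_unit a b\<close>, this coefficient makes
  \<open>M = mat 1 + (s * ramp x) *\<^sub>R E\<close> a solution of \<open>M' = (corner a b s x *\<^sub>R E) ** M\<close> on \<open>[0, 1]\<close>.\<close>

abbreviation corner :: "'n \<Rightarrow> 'n \<Rightarrow> real \<Rightarrow> real \<Rightarrow> real" where
  "corner a b s x \<equiv> s * ramp_rate x / (1 + s * (if a = b then 1 else 0) * ramp (min 1 (max 0 x)))"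

text \<open>Conjugation by \<open>fm\<close> is what makes \<open>fm x v ** M x\<close> solve the
  perturbed equation. With \<open>max 0 x\<close> the formula is continuous on the whole line, so
  shifted bumps can be added.\<close>

definition bump :: "'w \<Rightarrow> 'n \<Rightarrow> 'n \<Rightarrow> real \<Rightarrow> real \<Rightarrow> real^'n^'n" where
  "bump v a b s x = fm (max 0 x) v ** (corner a b s x *\<^sub>R matrix_unit a b) ** fmi (max 0 x) v"

text \<open>The denominator of \<open>corner\<close> is the determinant of the identity plus the
  ramped matrix unit; \<open>\<bar>s\<bar> \<le> 1/2\<close> keeps it away from 0.\<close>

lemma corner_denom:
  assumes "\<bar>s\<bar> \<le> 1/2"
  shows "1/2 \<le> 1 + s * (if a = b then 1 else 0) * ramp (min 1 (max 0 x))"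
proof -
  have r: "0 \<le> ramp (min 1 (max 0 x))" "ramp (min 1 (max 0 x)) \<le> 1"
    using ramp_bounds[of "min 1 (max 0 x)"] by auto
  then have "\<bar>s * ramp (min 1 (max 0 x))\<bar> \<le> (1/2) * 1"
    unfolding abs_mult using assms by (intro mult_mono) auto
  then show ?thesis by (auto simp: abs_le_iff)
qed

lemma bump_outside: "x \<le> 0 \<or> 1 \<le> x \<Longrightarrow> bump v a b s x = 0"
  by (simp add: bump_def ramp_rate_outside bounded_bilinear.zero_left[OF bounded_bilinear_matrix_matrix_mult]
      bounded_bilinear.zero_right[OF bounded_bilinear_matrix_matrix_mult])

lemma cont_bump:
  assumes "v \<in> W" "\<bar>s\<bar> \<le> 1/2"
  shows "continuous_on UNIV (bump v a b s)"
proof -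
  have "continuous_on UNIV (\<lambda>x. s * ramp_rate x)"
    unfolding ramp_rate_def by (intro continuous_intros)
  moreover have "continuous_on UNIV (\<lambda>x. 1 + s * (if a = b then 1 else 0) * ramp (min 1 (max 0 x)))"
    unfolding ramp_def by (intro continuous_intros)
  moreover have "1 + s * (if a = b then 1 else 0) * ramp (min 1 (max 0 x)) \<noteq> 0" for x
    using corner_denom[OF assms(2), of a b x] by linarith
  ultimately have "continuous_on UNIV (corner a b s)" by (intro continuous_on_divide) blast+
  moreover have max: "continuous_on UNIV (max (0::real))" by (intro continuous_intros)
  have "continuous_on UNIV (\<lambda>x. fm (max 0 x) v)"
    by (rule continuous_on_compose2[OF cont_fm[OF assms(1)] max]) auto
  moreover have "continuous_on UNIV (\<lambda>x. fmi (max 0 x) v)"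
    by (rule continuous_on_compose2[OF cont_fmi[OF assms(1)] max]) auto
  ultimately show ?thesis
    unfolding bump_def[abs_def]
    by (intro continuous_on_matrix_mult continuous_on_scaleR continuous_on_const)
qed

text \<open>The 3 is the maximum 3/2 of \<open>ramp_rate\<close> over the lower bound 1/2 of the
  denominator. Conjugation over time at most 1 costs \<open>(growth 1)\<^sup>2\<close>, whatever the
  length of the cell.\<close>

lemma norm_bump_le:
  assumes "v \<in> W" "\<bar>s\<bar> \<le> d" "d \<le> 1/2"
  shows "norm (bump v a b s x) \<le> 3 * d * (growth 1)\<^sup>2"
proof (cases "x \<le> 0 \<or> 1 \<le> x")
  case True
  then show ?thesis using assms by (auto simp: bump_outside)
next
  case False
  then have x: "0 \<le> x" "x \<le> 1" by auto
  have den: "1/2 \<le> 1 + s * (if a = b then 1 else 0) * ramp (min 1 (max 0 x))"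
    by (rule corner_denom) (use assms in auto)
  have c: "\<bar>corner a b s x\<bar> \<le> 3 * d"
  proof -
    have "\<bar>s * ramp_rate x\<bar> \<le> d * (3/2)"
      unfolding abs_mult using assms ramp_rate_bounds[of x] by (intro mult_mono) auto
    then have "\<bar>s * ramp_rate x\<bar> / \<bar>1 + s * (if a = b then 1 else 0) * ramp (min 1 (max 0 x))\<bar> \<le> (d * (3/2)) / (1/2)"
      using den assms by (intro frac_le) auto
    moreover have "(d * (3/2)) / (1/2) = 3 * d" by simp
    ultimately show ?thesis by (simp only: abs_divide)
  qed
  have f: "norm (fm x v) \<le> growth 1" "norm (fmi x v) \<le> growth 1"
    using norm_fm_le[OF assms(1) x(1)] norm_fmi_le[OF assms(1) x(1)] growth_mono[OF x(2)] by auto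
  have "norm (bump v a b s x) \<le>
      norm (fm (max 0 x) v) * norm (corner a b s x *\<^sub>R matrix_unit a b) * norm (fmi (max 0 x) v)"
    unfolding bump_def
    by (intro order.trans[OF norm_matrix_matrix_mult_le] mult_right_mono norm_matrix_matrix_mult_le norm_ge_zero)
  also have "\<dots> = norm (fm x v) * \<bar>corner a b s x\<bar> * norm (fmi x v)"
    by (simp only: max_absorb2[OF x(1)] norm_scaleR norm_matrix_unit mult_1_right real_norm_def)
  also have "\<dots> \<le> growth 1 * (3 * d) * growth 1"
    using f c growth_pos[of 1] assms
    by (intro mult_mono abs_ge_zero norm_ge_zero mult_nonneg_nonneg) linarith+
  finally show ?thesis by (simp add: power2_eq_square mult_ac)
qed

text \<open>Variation of constants, combined with the scalar shift, which commutes with everything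
  and contributes only \<open>exp (k * b)\<close>.\<close>

lemma fm_perturbed:
  assumes Y: "linear_skew_product W \<phi> Y" and v: "v \<in> W" and b: "0 \<le> b"
    and eq: "\<And>x. 0 \<le> x \<Longrightarrow> x \<le> b \<Longrightarrow>
      Y (\<phi> x v) = X (\<phi> x v) + k *\<^sub>R mat 1 + fm x v ** D x ** fmi x v"
    and M0: "M 0 = mat 1"
    and M: "\<And>x. 0 \<le> x \<Longrightarrow> x \<le> b \<Longrightarrow> (M has_vector_derivative (D x ** M x)) (at x within {0..b})"
  shows "fundamental_matrix \<phi> Y b v = exp (k * b) *\<^sub>R (fm b v ** M b)"
proof (rule linear_skew_product.fm_unique[OF Y v b order_refl])
  show "exp (k * 0) *\<^sub>R (fm 0 v ** M 0) = mat 1" by (simp add: fm_0 v M0)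
  fix x assume x: "0 \<le> x" "x \<le> b"
  have 1: "((\<lambda>x. fm x v ** M x) has_vector_derivative
      (fm x v ** (D x ** M x) + X (\<phi> x v) ** fm x v ** M x)) (at x within {0..b})"
    by (rule has_vector_derivative_matrix_mult[OF has_vector_derivative_within_subset[OF fm_deriv[OF v]] M])
       (use x in auto)
  have 2: "((\<lambda>x. exp (k * x)) has_vector_derivative (k * exp (k * x))) (at x within {0..b})"
    unfolding has_real_derivative_iff_has_vector_derivative[symmetric]
    by (rule derivative_eq_intros refl | simp)+
  have "Y (\<phi> x v) ** (exp (k * x) *\<^sub>R (fm x v ** M x)) =
     exp (k * x) *\<^sub>R (X (\<phi> x v) ** fm x v ** M x + k *\<^sub>R (fm x v ** M x)
       + fm x v ** D x ** (fmi x v ** fm x v) ** M x)"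
    by (simp add: eq[OF x] bounded_bilinear.add_left[OF bounded_bilinear_matrix_matrix_mult]
        bounded_bilinear.scaleR_left[OF bounded_bilinear_matrix_matrix_mult]
        bounded_bilinear.scaleR_right[OF bounded_bilinear_matrix_matrix_mult] matrix_mul_assoc)
  also have "\<dots> = exp (k * x) *\<^sub>R (fm x v ** (D x ** M x) + X (\<phi> x v) ** fm x v ** M x)
      + (k * exp (k * x)) *\<^sub>R (fm x v ** M x)"
    by (simp add: fmi_fm[OF v x(1)] matrix_mul_assoc algebra_simps)
  finally show "((\<lambda>x. exp (k * x) *\<^sub>R (fm x v ** M x)) has_vector_derivative
      Y (\<phi> x v) ** (exp (k * x) *\<^sub>R (fm x v ** M x))) (at x within {0..b})"
    using bounded_bilinear.has_vector_derivative[OF bounded_bilinear_scaleR 2 1] by simp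
qed

lemma fm_bump:
  assumes Y: "linear_skew_product W \<phi> Y" and v: "v \<in> W" and r: "1 \<le> r" and s: "\<bar>s\<bar> \<le> 1/2"
    and eq: "\<And>x. 0 \<le> x \<Longrightarrow> x \<le> r \<Longrightarrow> Y (\<phi> x v) = X (\<phi> x v) + k *\<^sub>R mat 1 + bump v a b s x"
  shows "fundamental_matrix \<phi> Y r v = exp (k * r) *\<^sub>R (fm r v ** (mat 1 + s *\<^sub>R matrix_unit a b))"
proof -
  let ?E = "matrix_unit a b"
  have 1: "fundamental_matrix \<phi> Y 1 v = exp (k * 1) *\<^sub>R (fm 1 v ** (mat 1 + (s * ramp 1) *\<^sub>R ?E))"
  proof (rule fm_perturbed[OF Y v, where D = "\<lambda>x. corner a b s x *\<^sub>R ?E" and M = "\<lambda>x. mat 1 + (s * ramp x) *\<^sub>R ?E"])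
    fix x :: real assume x: "0 \<le> x" "x \<le> 1"
    show "Y (\<phi> x v) = X (\<phi> x v) + k *\<^sub>R mat 1 + fm x v ** (corner a b s x *\<^sub>R ?E) ** fmi x v"
      using eq[of x] x r by (simp add: bump_def)
    have "((\<lambda>x. s * ramp x) has_vector_derivative (s * ramp_rate x)) (at x within {0..1})"
      unfolding has_real_derivative_iff_has_vector_derivative[symmetric]
      by (intro DERIV_cmult ramp_deriv x)
    from has_vector_derivative_add[OF has_vector_derivative_const[of "mat 1"]
        bounded_linear.has_vector_derivative[OF bounded_linear_scaleR_left this, of ?E]]
    have "((\<lambda>x. mat 1 + (s * ramp x) *\<^sub>R ?E) has_vector_derivative ((s * ramp_rate x) *\<^sub>R ?E)) (at x within {0..1})"
      by simp
    also have "(s * ramp_rate x) *\<^sub>R ?E = corner a b s x *\<^sub>R ?E ** (mat 1 + (s * ramp x) *\<^sub>R ?E)"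
    proof -
      have "?E ** (mat 1 + (s * ramp x) *\<^sub>R ?E) = (1 + s * (if a = b then 1 else 0) * ramp x) *\<^sub>R ?E"
        by (simp add: bounded_bilinear.add_right[OF bounded_bilinear_matrix_matrix_mult]
          bounded_bilinear.scaleR_right[OF bounded_bilinear_matrix_matrix_mult] matrix_unit_sq algebra_simps)
      moreover have "1 + s * (if a = b then 1 else 0) * ramp x \<noteq> 0"
        using corner_denom[OF s, of a b x] x by auto
      ultimately show ?thesis
        using x by (simp add: bounded_bilinear.scaleR_left[OF bounded_bilinear_matrix_matrix_mult])
    qed
    finally show "((\<lambda>x. mat 1 + (s * ramp x) *\<^sub>R ?E) has_vector_derivative
        (corner a b s x *\<^sub>R ?E ** (mat 1 + (s * ramp x) *\<^sub>R ?E))) (at x within {0..1})" .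
  qed (auto simp: ramp_0)
  have v1: "\<phi> 1 v \<in> W" using v by (simp add: flow_in)
  \<comment> \<open>After the first unit of time the bump is over, so only the scalar shift
    acts.\<close>
  have 2: "fundamental_matrix \<phi> Y (r - 1) (\<phi> 1 v) = exp (k * (r - 1)) *\<^sub>R (fm (r - 1) (\<phi> 1 v) ** mat 1)"
  proof (rule fm_perturbed[OF Y v1, where D = "\<lambda>x. 0" and M = "\<lambda>x. mat 1"])
    fix x assume x: "0 \<le> x" "x \<le> r - 1"
    have "\<phi> x (\<phi> 1 v) = \<phi> (x + 1) v" using x v by (simp add: flow_add)
    then show "Y (\<phi> x (\<phi> 1 v)) = X (\<phi> x (\<phi> 1 v)) + k *\<^sub>R mat 1 + fm x (\<phi> 1 v) ** 0 ** fmi x (\<phi> 1 v)"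
      using eq[of "x + 1"] x by (simp add: bump_outside
          bounded_bilinear.zero_left[OF bounded_bilinear_matrix_matrix_mult]
          bounded_bilinear.zero_right[OF bounded_bilinear_matrix_matrix_mult])
  qed (use r in \<open>auto simp: bounded_bilinear.zero_left[OF bounded_bilinear_matrix_matrix_mult]\<close>)
  have "fundamental_matrix \<phi> Y ((r - 1) + 1) v = fundamental_matrix \<phi> Y (r - 1) (\<phi> 1 v) ** fundamental_matrix \<phi> Y 1 v"
    by (rule linear_skew_product.fm_add[OF Y v]) (use r in auto)
  also have "\<dots> = exp (k * (r - 1) + k) *\<^sub>R (fm (r - 1) (\<phi> 1 v) ** fm 1 v ** (mat 1 + s *\<^sub>R ?E))"
    unfolding 1 2
    by (simp add: bounded_bilinear.scaleR_left[OF bounded_bilinear_matrix_matrix_mult] exp_add ramp_1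
        bounded_bilinear.scaleR_right[OF bounded_bilinear_matrix_matrix_mult] matrix_mul_assoc mult.commute)
  also have "fm (r - 1) (\<phi> 1 v) ** fm 1 v = fm ((r - 1) + 1) v"
    by (rule fm_add[symmetric, OF v]) (use r in auto)
  finally show ?thesis by (simp add: algebra_simps)
qed

text \<open>Cells have length at least 1, so the supports do not overlap. The end
  \<open>x = r\<close> is included: the next bump still vanishes there.\<close>

lemma sum_bumps_cell:
  assumes r: "1 \<le> r" and j: "j < m" and x: "0 \<le> x" "x \<le> r"
  shows "(\<Sum>i<m. bump (v i) (a i) (b i) (s i) (real j * r + x - real i * r)) = bump (v j) (a j) (b j) (s j) x"
proof -
  have "bump (v i) (a i) (b i) (s i) (real j * r + x - real i * r) = 0" if "i \<noteq> j" for i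
  proof (rule bump_outside)
    show "real j * r + x - real i * r \<le> 0 \<or> 1 \<le> real j * r + x - real i * r"
    proof (cases "i < j")
      case True
      then have "1 * r \<le> (real j - real i) * r" using r by (intro mult_right_mono) auto
      then show ?thesis using r x by (simp add: algebra_simps)
    next
      case False
      then have "1 * r \<le> (real i - real j) * r" using that r by (intro mult_right_mono) auto
      then show ?thesis using r x by (simp add: algebra_simps)
    qed
  qed
  then have "(\<Sum>i<m. bump (v i) (a i) (b i) (s i) (real j * r + x - real i * r))
      = (\<Sum>i\<in>{j}. bump (v i) (a i) (b i) (s i) (real j * r + x - real i * r))"
    using j by (intro sum.mono_neutral_right) auto
  then show ?thesis by simp
qed

text \<open>The upper bound \<open>2 * T\<close> on the cell length serves the later comparison with
  the grid: it makes the rounding cost uniform over all orbits.\<close>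

lemma sum_ln_norm_le_of_minimal_period:
  assumes e: "0 < e" and stable: "\<And>Y w \<tau>. continuous_on W Y \<Longrightarrow> (\<And>x. x \<in> W \<Longrightarrow> norm (Y x - X x) \<le> e) \<Longrightarrow>
      periodic_point W \<phi> w \<tau> \<Longrightarrow> \<exists>K. \<forall>t\<ge>0. norm (fundamental_matrix \<phi> Y t w) \<le> K"
  obtains k T where "0 < k" "1 \<le> T"
    "\<And>w p. w \<in> W \<Longrightarrow> T < p \<Longrightarrow> \<phi> p w = w \<Longrightarrow> (\<And>r. 0 < r \<Longrightarrow> r < p \<Longrightarrow> \<phi> r w \<noteq> w) \<Longrightarrow>
      \<exists>m>0. T \<le> p / real m \<and> p / real m \<le> 2 * T \<and>
        (\<Sum>j<m. ln (norm (fm (p / real m) (\<phi> (real j * (p / real m)) w)))) \<le> - k * p"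
proof -
  define c where "c = (real CARD('n))\<^sup>2"
  have c: "1 \<le> c" by (simp add: c_def Suc_leI)
  \<comment> \<open>Half of the budget \<open>e\<close> goes to the scalar shift and half to the
    extended bumps; \<open>c\<close> bounds both the norm of the identity and the loss in the
    extension.\<close>
  define k where "k = e / (2 * c)"
  have k: "0 < k" using e c by (simp add: k_def)
  \<comment> \<open>Small enough for bumps of norm at most \<open>k\<close>, and at most 1/2 for
    \<open>corner_denom\<close>.\<close>
  define d where "d = min (1/2) (k / (3 * (growth 1)\<^sup>2))"
  have g: "0 < (growth 1)\<^sup>2" using growth_pos[of 1] by (rule zero_less_power)
  have "0 < k / (3 * (growth 1)\<^sup>2)" using k g by (intro divide_pos_pos mult_pos_pos) auto
  then have d: "0 < d" "d \<le> 1/2" by (auto simp: d_def)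
  have dk: "3 * d * (growth 1)\<^sup>2 \<le> k"
  proof -
    have "d \<le> k / (3 * (growth 1)\<^sup>2)" by (simp add: d_def)
    then have "d * (3 * (growth 1)\<^sup>2) \<le> k" using g by (subst (asm) pos_le_divide_eq) auto
    then show ?thesis by (simp only: mult_ac)
  qed
  define q where "q = d / c"
  have q: "0 < q" using c d by (simp add: q_def)
  \<comment> \<open>The loss charged per cell: the trace bound, and the factor \<open>q\<close> lost
    in making the trace large.\<close>
  define R where "R = ln (2 * real CARD('n)) - ln q"
  define T where "T = max 1 (2 * R / k)"
  have T: "1 \<le> T" by (simp add: T_def)
  have RT: "2 * R \<le> k * T" 
  proof -
    have "2 * R / k \<le> T" by (simp add: T_def)
    then show ?thesis using k by (simp add: field_simps)
  qed
  show thesis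
  \<comment> \<open>Half of the rate \<open>k\<close> pays for the losses \<open>R\<close>: there
    are at most \<open>p / T\<close> cells, and \<open>2 * R \<le> k * T\<close>.\<close>
  proof (rule that[of "k / 2" T])
    fix w p assume w: "w \<in> W" and p: "T < p" "\<phi> p w = w" and min: "\<And>r. 0 < r \<Longrightarrow> r < p \<Longrightarrow> \<phi> r w \<noteq> w"
    \<comment> \<open>The largest number of equal cells of length at least \<open>T\<close>; they
      are no longer than \<open>2 * T\<close> because \<open>m + 1 \<le> 2 * m\<close>.\<close>
    define m where "m = nat \<lfloor>p / T\<rfloor>"
    have "1 \<le> p / T" using p T by simp
    then have m: "0 < m" "real m \<le> p / T" "p / T < real m + 1"
      unfolding m_def by linarith+
    define r where "r = p / real m"
    have mr: "real m * r = p" using m by (simp add: r_def)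
    have rT: "T \<le> r" "r \<le> 2 * T"
    proof -
      show "T \<le> r" using m T by (simp add: r_def field_simps)
      have "p < (real m + 1) * T" using m T by (simp add: field_simps)
      also have "\<dots> \<le> (2 * real m) * T" using m T by (intro mult_right_mono) auto
      finally show "r \<le> 2 * T" using m by (simp add: r_def field_simps)
    qed
    have r: "1 \<le> r" using rT T by simp
    define v where "v j = \<phi> (real j * r) w" for j
    have vW: "v j \<in> W" for j using w r by (simp add: v_def flow_in)
    define A where "A j = fm r (v j)" for j
    obtain a b s where s: "\<And>j. \<bar>s j\<bar> \<le> d"
      and tr: "(\<Prod>j<m. d / c * norm (A j)) \<le>
         \<bar>trace (step_product A (\<lambda>j. mat 1 + s j *\<^sub>R matrix_unit (a j) (b j)) m)\<bar>"
    proof (rule exists_perturbation_large_trace[OF d(1) _ m(1), of A])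
      show "d \<le> 1" using d by simp
    qed (rule that[unfolded c_def])
    have s2: "\<bar>s j\<bar> \<le> 1/2" for j using s d by (meson order_trans)
    define f where "f u = (\<Sum>i<m. bump (v i) (a i) (b i) (s i) (u - real i * r))" for u
    have f_cell: "f (real j * r + x) = bump (v j) (a j) (b j) (s j) x" if "j < m" "0 \<le> x" "x \<le> r" for j x
      unfolding f_def by (rule sum_bumps_cell[OF r that])
    have f_cont: "continuous_on {0..p} f"
      unfolding f_def[abs_def]
      by (intro continuous_on_sum continuous_on_compose2[OF cont_bump[OF vW s2]] continuous_intros) auto
    \<comment> \<open>The orbit identifies only the times 0 and \<open>p\<close>, so vanishing at
      both makes \<open>f\<close> a function of the orbit point.\<close>
    have f0: "f 0 = 0" using f_cell[of 0 0] m r by (simp add: bump_outside)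
    have fp: "f p = 0"
    proof -
      have "real (m - 1) * r + r = p" using m mr by (simp add: of_nat_diff algebra_simps)
      then show ?thesis using f_cell[of "m - 1" r] m r by (simp add: bump_outside)
    qed
    have f_bd: "norm (f t) \<le> k" if t: "t \<in> {0..p}" for t
    proof (cases "t = p")
      case False
      define j where "j = nat \<lfloor>t / r\<rfloor>"
      have "0 \<le> t / r" using t r by simp
      then have j: "real j \<le> t / r" "t / r < real j + 1" unfolding j_def by linarith+
      have "t / r < real m" using t False r mr by (simp add: field_simps)
      then have jm: "j < m" using j by linarith
      have "0 \<le> t - real j * r" "t - real j * r \<le> r" using j r by (simp_all add: field_simps)
      from f_cell[OF jm this] have "f t = bump (v j) (a j) (b j) (s j) (t - real j * r)" by simp
      with norm_bump_le[OF vW s d(2)] dk show ?thesis by (metis order_trans)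
    qed (use fp k in simp)
    have resp: "f x = f y" if "x \<in> {0..p}" "y \<in> {0..p}" "\<phi> x w = \<phi> y w" for x y
    proof -
      consider "x = y" | "x < y" | "y < x" by linarith
      then show ?thesis
      proof cases
        case 2
        with orbit_injective[OF w p(2) min, of x y] that f0 fp show ?thesis by auto
      next
        case 3
        with orbit_injective[OF w p(2) min, of y x] that f0 fp show ?thesis by auto
      qed simp
    qed
    have "continuous_on {0..p} (\<lambda>t. \<phi> t w)" by (rule continuous_on_subset[OF cont_orbit[OF w]]) auto
    then obtain B where B: "continuous_on UNIV B" "\<And>t. t \<in> {0..p} \<Longrightarrow> B (\<phi> t w) = f t"
      "\<And>x. norm (B x) \<le> c * k"
    proof (rule extend_from_closed_curve_matrix[OF _ f_cont])
      show "f x = f y" if "x \<in> {0..p}" "y \<in> {0..p}" "\<phi> x w = \<phi> y w" for x y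
        using that by (rule resp)
      show "norm (f t) \<le> k" if "t \<in> {0..p}" for t using that by (rule f_bd)
      show "0 \<le> k" using k by simp
    qed (rule that[unfolded c_def])
    define Y where "Y x = X x + k *\<^sub>R mat 1 + B x" for x
    have contY: "continuous_on W Y"
      unfolding Y_def[abs_def] by (intro continuous_intros cont_X continuous_on_subset[OF B(1)]) auto
    have Y: "linear_skew_product W \<phi> Y" by unfold_locales (rule compact_W semiflow contY)+
    have n1: "norm (mat 1 :: real^'n^'n) \<le> c * 1"
      unfolding c_def by (rule norm_matrix_le_card) (simp add: mat_def)
    have YX: "norm (Y x - X x) \<le> e" for x
    proof -
      have "norm (Y x - X x) \<le> norm (k *\<^sub>R mat 1 :: real^'n^'n) + norm (B x)"
        unfolding Y_def by (simp add: norm_triangle_ineq add.assoc del: norm_scaleR)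
      also have "\<dots> \<le> k * c + c * k" using n1 k B(3)[of x] by (intro add_mono) auto
      also have "\<dots> = e" using c by (simp add: k_def field_simps)
      finally show ?thesis .
    qed
    have per: "periodic_point W \<phi> w p" using w p T by (simp add: periodic_point_def)
    from stable[OF contY YX per] obtain K where K: "\<And>t. 0 \<le> t \<Longrightarrow> norm (fundamental_matrix \<phi> Y t w) \<le> K"
      by blast
    let ?B = "\<lambda>j. mat 1 + s j *\<^sub>R matrix_unit (a j) (b j)"
    have cell: "fundamental_matrix \<phi> Y r (v j) = exp (k * r) *\<^sub>R (A j ** ?B j)" if j: "j < m" for j
      unfolding A_def
    proof (rule fm_bump[OF Y vW r s2])
      fix x assume x: "0 \<le> x" "x \<le> r"
      have "real j * r + x \<le> (real j + 1) * r" using x by (simp add: algebra_simps)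
      also have "\<dots> \<le> real m * r" using j r by (intro mult_right_mono) auto
      finally have "real j * r + x \<in> {0..p}" using mr x r by auto
      from B(2)[OF this] f_cell[OF j x]
      have "B (\<phi> (real j * r + x) w) = bump (v j) (a j) (b j) (s j) x" by simp
      moreover have "\<phi> (x + real j * r) w = \<phi> x (v j)" unfolding v_def using x r w by (intro flow_add) auto
      ultimately show "Y (\<phi> x (v j)) = X (\<phi> x (v j)) + k *\<^sub>R mat 1 + bump (v j) (a j) (b j) (s j) x"
        by (simp add: Y_def add.commute)
    qed
    have steps: "fundamental_matrix \<phi> Y (real j * r) w = exp (k * (real j * r)) *\<^sub>R step_product A ?B j"
      if "j \<le> m" for j
      using that
    proof (induction j)
      case 0
      then show ?case by (simp add: linear_skew_product.fm_0[OF Y w])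
    next
      case (Suc j)
      have "fundamental_matrix \<phi> Y (r + real j * r) w
          = fundamental_matrix \<phi> Y r (v j) ** fundamental_matrix \<phi> Y (real j * r) w"
        unfolding v_def by (rule linear_skew_product.fm_add[OF Y w]) (use r in auto)
      also have "\<dots> = exp (k * (r + real j * r)) *\<^sub>R (A j ** ?B j ** step_product A ?B j)"
        using Suc by (simp add: cell exp_add distrib_left
            bounded_bilinear.scaleR_left[OF bounded_bilinear_matrix_matrix_mult]
            bounded_bilinear.scaleR_right[OF bounded_bilinear_matrix_matrix_mult])
      finally show ?case by (simp add: algebra_simps)
    qed
    define Q where "Q = fundamental_matrix \<phi> Y p w"
    have p0: "0 \<le> p" using p T by simp
    have "norm (((**) Q ^^ n) (mat 1)) \<le> K" for n
      using K[of "real n * p"] linear_skew_product.fm_multiple_period[OF Y w p0 p(2), of n] p0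
      by (simp add: Q_def)
    then have "\<bar>trace Q\<bar> \<le> 2 * real CARD('n)" by (rule abs_trace_le_of_bounded_powers)
    moreover have "trace Q = exp (k * p) * trace (step_product A ?B m)"
      using steps[of m] mr by (simp add: Q_def trace_def sum_distrib_left)
    ultimately have "exp (k * p) * \<bar>trace (step_product A ?B m)\<bar> \<le> 2 * real CARD('n)"
      by (simp add: abs_mult)
    moreover have "exp (k * p) * (\<Prod>j<m. q * norm (A j)) \<le> exp (k * p) * \<bar>trace (step_product A ?B m)\<bar>"
      using tr by (intro mult_left_mono) (auto simp: q_def)
    \<comment> \<open>The right side does not depend on \<open>p\<close>, so the factor
      \<open>exp (k * p)\<close> forces the weighted product of the cell norms to be exponentially
      small.\<close>
    ultimately have le: "exp (k * p) * (\<Prod>j<m. q * norm (A j)) \<le> 2 * real CARD('n)" by linarith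
    have Apos: "0 < norm (A j)" for j using fm_nonzero[OF vW, of r] r by (simp add: A_def)
    have pos: "0 < (\<Prod>j<m. q * norm (A j))" using Apos q by (intro prod_pos) simp
    have "ln (exp (k * p) * (\<Prod>j<m. q * norm (A j))) \<le> ln (2 * real CARD('n))"
      using le pos by (intro ln_mono) auto
    moreover have "ln (exp (k * p) * (\<Prod>j<m. q * norm (A j))) = k * p + (\<Sum>j<m. ln (q * norm (A j)))"
      using pos q Apos by (subst ln_mult) (auto simp: ln_prod)
    moreover have "(\<Sum>j<m. ln (q * norm (A j))) = real m * ln q + (\<Sum>j<m. ln (norm (A j)))"
      using q Apos by (simp add: ln_mult sum.distrib)
    ultimately have "(\<Sum>j<m. ln (norm (A j))) \<le> - k * p + (ln (2 * real CARD('n)) - real m * ln q)"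
      by linarith
    also have "\<dots> \<le> - k * p + real m * R"
    proof -
      \<comment> \<open>The trace bound is paid once per period; charging it to every cell is
        harmless since \<open>m \<ge> 1\<close>.\<close>
      have "1 * ln (2 * real CARD('n)) \<le> real m * ln (2 * real CARD('n))"
      proof (intro mult_right_mono ln_ge_zero)
        show "1 \<le> real m" using m(1) by linarith
        have "1 \<le> CARD('n)" by (simp add: Suc_leI)
        then show "1 \<le> 2 * real CARD('n)" by linarith
      qed
      then show ?thesis by (simp add: R_def algebra_simps)
    qed
    also have "\<dots> \<le> - k * p + (k / 2) * p"
    proof -
      have "real m * (2 * R) \<le> real m * (k * T)" using RT by (intro mult_left_mono) auto
      also have "\<dots> \<le> (p / T) * (k * T)" using m k T by (intro mult_right_mono) auto
      also have "\<dots> = k * p" using T by simp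
      finally show ?thesis by simp
    qed
    finally have "(\<Sum>j<m. ln (norm (A j))) \<le> - (k / 2) * p" by (simp add: field_simps)
    then show "\<exists>m>0. T \<le> p / real m \<and> p / real m \<le> 2 * T \<and>
        (\<Sum>j<m. ln (norm (fm (p / real m) (\<phi> (real j * (p / real m)) w)))) \<le> - (k / 2) * p"
      using m(1) rT by (intro exI[of _ m]) (simp add: A_def v_def r_def)
  qed (use k T in auto)
qed

subsection \<open>Short periods and arbitrary subdivisions\<close>

text \<open>Return times in \<open>{T..\<tau>}\<close> form a compact set, and \<open>none\<close>
  rules out smaller ones, so a least return time exists. Division with remainder then shows that it
  divides \<tau>.\<close>

lemma exists_minimal_period:
  assumes w: "w \<in> W" and \<tau>: "0 < \<tau>" "\<phi> \<tau> w = w" and T: "0 < T"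
    and none: "\<And>r. 0 < r \<Longrightarrow> r \<le> T \<Longrightarrow> \<phi> r w \<noteq> w"
  obtains p n where "T < p" "\<phi> p w = w" "\<And>r. 0 < r \<Longrightarrow> r < p \<Longrightarrow> \<phi> r w \<noteq> w" "\<tau> = real n * p"
proof -
  let ?P = "{T..\<tau>} \<inter> (\<lambda>r. \<phi> r w) -` {w}"
  have "closed ?P"
    by (rule continuous_closed_preimage) (use T in \<open>auto intro: continuous_on_subset[OF cont_orbit[OF w]]\<close>)
  then have "compact ?P" by (metis compact_Icc compact_Int_closed inf.left_idem)
  moreover have "T < \<tau>" using none[of \<tau>] \<tau> by linarith
  then have "\<tau> \<in> ?P" using \<tau> by simp
  then have "?P \<noteq> {}" by blast
  ultimately have "\<exists>p\<in>?P. \<forall>r\<in>?P. p \<le> r" by (rule compact_attains_inf)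
  then obtain p where p: "p \<in> ?P" and least: "\<forall>r\<in>?P. p \<le> r" by (rule bexE)
  have Tp: "T < p" and pp: "p \<le> \<tau>" "\<phi> p w = w" using p none[of p] T by (auto simp: less_le)
  have min: "\<phi> r w \<noteq> w" if r: "0 < r" "r < p" for r
  proof
    assume "\<phi> r w = w"
    moreover from this have "T < r" using none[OF r(1)] by (meson not_le)
    ultimately have "r \<in> ?P" using r(2) pp by simp
    then have "p \<le> r" by (rule bspec[OF least])
    with r show False by simp
  qed
  define n where "n = nat \<lfloor>\<tau> / p\<rfloor>"
  have "0 \<le> \<tau> / p" using \<tau> Tp T by simp
  then have "real n \<le> \<tau> / p" "\<tau> / p < real n + 1" unfolding n_def by linarith+
  then have rem: "0 \<le> \<tau> - real n * p" "\<tau> - real n * p < p"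
    using Tp T by (simp_all add: field_simps)
  have np: "\<phi> (real n * p) w = w" using pp Tp T w by (intro flow_multiple_period) auto
  have "\<phi> (\<tau> - real n * p + real n * p) w = \<phi> (\<tau> - real n * p) (\<phi> (real n * p) w)"
    using rem Tp T w by (intro flow_add) auto
  then have "\<phi> (\<tau> - real n * p) w = w" using np \<tau> by simp
  then have "\<tau> = real n * p" using min[of "\<tau> - real n * p"] rem by linarith
  from that[OF Tp pp(2) min this] show thesis .
qed

text \<open>Projection to \<open>W\<close> of a closed subset of a compact product. A positive
  \<open>S\<close> is what excludes the trivial return time 0.\<close>

lemma compact_bounded_period_points:
  assumes "0 \<le> S"
  shows "compact {w \<in> W. \<exists>r\<in>{S..T}. \<phi> r w = w}"
proof -
  let ?S = "{S..T} \<times> W" and ?h = "\<lambda>x. dist (\<phi> (fst x) (snd x)) (snd x)"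
  have S: "compact ?S" by (intro compact_Times compact_W compact_Icc)
  have "continuous_on ?S ?h"
    by (intro continuous_on_dist continuous_on_snd continuous_on_id
        continuous_on_subset[OF cont_flow[unfolded case_prod_unfold]]) (use assms in auto)
  then have "closed (?S \<inter> ?h -` {0})"
    by (intro continuous_closed_preimage compact_imp_closed[OF S]) auto
  then have "compact (?S \<inter> ?h -` {0})" by (metis S compact_Int_closed inf.left_idem)
  then have "compact (snd ` (?S \<inter> ?h -` {0}))"
    by (intro compact_continuous_image continuous_on_snd continuous_on_id)
  also have "snd ` (?S \<inter> ?h -` {0}) = {w \<in> W. \<exists>r\<in>{S..T}. \<phi> r w = w}"
    by (force simp: image_iff)
  finally show ?thesis .
qed

text \<open>A norm below 1/2 at a fixed time is an open condition on the point, so on a compact set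
  finitely many such times suffice. Forward invariance of that set lets the halving be
  iterated.\<close>

lemma short_period_decay:
  assumes T: "0 < T"
    and stable: "\<And>w \<tau>. periodic_point W \<phi> w \<tau> \<Longrightarrow> \<exists>t\<ge>1. norm (fm t w) < 1/2"
  obtains C c where "0 < C" "0 < c"
    "\<And>w r t. w \<in> W \<Longrightarrow> 0 < r \<Longrightarrow> r \<le> T \<Longrightarrow> \<phi> r w = w \<Longrightarrow> 0 \<le> t \<Longrightarrow> norm (fm t w) \<le> C * exp (- c * t)"
proof -
  \<comment> \<open>Any period in \<open>(0, T]\<close> has a multiple in this window, which stays
    away from 0.\<close>
  define K where "K = {w \<in> W. \<exists>r\<in>{T..2 * T}. \<phi> r w = w}"
  have cK: "compact K" unfolding K_def using T by (intro compact_bounded_period_points) simp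
  have KW: "w \<in> W" if "w \<in> K" for w using that by (simp add: K_def)
  have "\<exists>t\<ge>1. norm (fm t w) < 1/2" if w: "w \<in> K" for w
  proof -
    obtain r where "r \<in> {T..2 * T}" "\<phi> r w = w" using w by (auto simp: K_def)
    then have "periodic_point W \<phi> w r" using T KW[OF w] by (auto simp: periodic_point_def)
    then show ?thesis by (rule stable)
  qed
  then obtain \<theta> where \<theta>: "\<And>w. w \<in> K \<Longrightarrow> 1 \<le> \<theta> w" "\<And>w. w \<in> K \<Longrightarrow> norm (fm (\<theta> w) w) < 1/2" by metis
  have "\<exists>d>0. \<forall>v\<in>W. dist v w < d \<longrightarrow> norm (fm (\<theta> w) v) < 1/2" if w: "w \<in> K" for w
  proof -
    have "continuous_on W (\<lambda>v. norm (fm (\<theta> w) v))"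
      using \<theta>(1)[OF w] by (intro continuous_on_norm cont_fm_point) simp
    then obtain d where "d > 0" "\<forall>v\<in>W. dist v w < d \<longrightarrow>
        dist (norm (fm (\<theta> w) v)) (norm (fm (\<theta> w) w)) < 1/2 - norm (fm (\<theta> w) w)"
      using KW[OF w] \<theta>(2)[OF w] unfolding continuous_on_iff by (metis diff_gt_0_iff_gt)
    then show ?thesis by (intro exI[of _ d]) (fastforce simp: dist_real_def)
  qed
  then obtain \<delta> where \<delta>: "\<And>w. w \<in> K \<Longrightarrow> 0 < \<delta> w"
    "\<And>w v. w \<in> K \<Longrightarrow> v \<in> W \<Longrightarrow> dist v w < \<delta> w \<Longrightarrow> norm (fm (\<theta> w) v) < 1/2" by metis
  obtain F where F: "F \<subseteq> K" "finite F" "K \<subseteq> (\<Union>w\<in>F. ball w (\<delta> w))"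
  proof (rule compactE_image[OF cK])
    show "K \<subseteq> (\<Union>w\<in>K. ball w (\<delta> w))" using \<delta>(1) centre_in_ball by blast
  qed (rule open_ball)
  \<comment> \<open>A sum in place of a maximum bounds all the chosen times even when
    \<open>F\<close> is empty, and gives \<open>M \<ge> 1\<close>.\<close>
  define M where "M = 1 + (\<Sum>w\<in>F. \<theta> w)"
  have th0: "0 \<le> \<theta> w" if "w \<in> F" for w using \<theta>(1)[of w] F(1) that by fastforce
  have M: "1 \<le> M" using sum_nonneg[of F \<theta>] th0 by (simp add: M_def)
  have step: "\<exists>t. 1 \<le> t \<and> t \<le> M \<and> norm (fm t v) \<le> 1/2" if v: "v \<in> K" for v
  proof -
    obtain w where w: "w \<in> F" "dist v w < \<delta> w" using F(3) v by (auto simp: dist_commute)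
    have "\<theta> w \<le> M" using member_le_sum[of w F \<theta>] w(1) th0 F(2) by (simp add: M_def)
    moreover have "norm (fm (\<theta> w) v) < 1/2" using \<delta>(2)[of w v] w F(1) KW[OF v] by auto
    ultimately show ?thesis using \<theta>(1)[of w] w(1) F(1) by (intro exI[of _ "\<theta> w"]) auto
  qed
  have inv: "\<phi> t v \<in> K" if v: "v \<in> K" and t: "0 \<le> t" for v t
  proof -
    obtain r where r: "r \<in> {T..2 * T}" "\<phi> r v = v" using v by (auto simp: K_def)
    have "\<phi> r (\<phi> t v) = \<phi> t (\<phi> r v)"
      using flow_add[of r t v] flow_add[of t r v] r T t KW[OF v] by (simp add: add.commute)
    then show ?thesis using r KW[OF v] t by (auto simp: K_def flow_in intro!: bexI[of _ r])
  qed
  \<comment> \<open>One halving per time \<open>M\<close>; the 2 in \<open>C\<close> covers times up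
    to \<open>M\<close>, where \<open>exp (- c * t)\<close> is still at least 1/2.\<close>
  define c where "c = ln 2 / M"
  define C where "C = 2 * growth M"
  have c: "0 < c" using M by (simp add: c_def)
  have C: "0 < C" using growth_pos[of M] by (simp add: C_def)
  have cM: "exp (c * M) = 2" using M by (simp add: c_def)
  \<comment> \<open>Induction on an integer bound for \<open>t\<close>: each halving uses time at
    least 1, so it lowers that bound by one.\<close>
  have decay: "norm (fm t v) \<le> C * exp (- c * t)" if "v \<in> K" "0 \<le> t" "t \<le> real n" for n t v
    using that
  proof (induction n arbitrary: t v)
    case 0
    then have "norm (fm t v) \<le> growth M" using norm_fm_le[of v t] KW growth_mono[of t M] M by auto
    then show ?case using 0 growth_pos[of M] by (simp add: C_def)
  next
    case (Suc n)
    show ?case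
    proof (cases "t \<le> M")
      case True
      have "norm (fm t v) \<le> growth M"
        using norm_fm_le[of v t] KW growth_mono[OF True] Suc.prems by force
      moreover have "exp (- c * M) \<le> exp (- c * t)" using True c by simp
      then have "1/2 \<le> exp (- c * t)" using cM by (simp add: exp_minus)
      then have "C * (1/2) \<le> C * exp (- c * t)" using C by (intro mult_left_mono) auto
      ultimately show ?thesis by (simp add: C_def)
    next
      case False
      obtain s where s: "1 \<le> s" "s \<le> M" "norm (fm s v) \<le> 1/2" using step[OF Suc.prems(1)] by blast
      have "fm (t - s + s) v = fm (t - s) (\<phi> s v) ** fm s v"
        using False s KW[OF Suc.prems(1)] by (intro fm_add) auto
      then have "norm (fm t v) \<le> norm (fm (t - s) (\<phi> s v)) * norm (fm s v)"
        by (simp add: norm_matrix_matrix_mult_le)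
      also have "\<dots> \<le> (C * exp (- c * (t - s))) * (1/2)"
        using Suc.IH[of "\<phi> s v" "t - s"] inv[OF Suc.prems(1), of s] s False Suc.prems C
        by (intro mult_mono) auto
      also have "\<dots> = C * exp (- c * t) * (exp (c * s) / 2)" by (simp add: algebra_simps flip: exp_add)
      also have "\<dots> \<le> C * exp (- c * t) * 1"
      proof (intro mult_left_mono)
        have "exp (c * s) \<le> exp (c * M)" using s c by simp
        then show "exp (c * s) / 2 \<le> 1" using cM by simp
      qed (use C in auto)
      finally show ?thesis by simp
    qed
  qed
  show thesis
  proof (rule that[OF C c])
    fix w and r t :: real assume w: "w \<in> W" and r: "0 < r" "r \<le> T" "\<phi> r w = w" and t: "0 \<le> t"
    define n where "n = nat \<lceil>T / r\<rceil>"
    have "0 \<le> T / r" using T r by simp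
    then have "T / r \<le> real n" "real n < T / r + 1" unfolding n_def by linarith+
    then have "T \<le> real n * r" "real n * r \<le> 2 * T" using r by (simp_all add: field_simps)
    moreover have "\<phi> (real n * r) w = w" using w r by (intro flow_multiple_period) auto
    ultimately have "w \<in> K" using w by (auto simp: K_def)
    moreover obtain k where "t \<le> real k" using real_arch_simple by blast
    ultimately show "norm (fm t w) \<le> C * exp (- c * t)" using decay t by blast
  qed
qed

section \<open>Comparison of segments with a grid\<close>

lemma norm_fm_multiple_le:
  assumes w: "w \<in> W" and r: "0 \<le> r"
  shows "norm (fm (real n * r) w) \<le> growth 0 * (\<Prod>k<n. norm (fm r (\<phi> (real k * r) w)))"
proof (induction n)
  case 0
  then show ?case by (simp add: fm_0 w growth_def)
next
  case (Suc n)
  have "fm (r + real n * r) w = fm r (\<phi> (real n * r) w) ** fm (real n * r) w"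
    using r w by (intro fm_add) auto
  then have "norm (fm (real (Suc n) * r) w) \<le> norm (fm r (\<phi> (real n * r) w)) * norm (fm (real n * r) w)"
    by (simp add: distrib_right norm_matrix_matrix_mult_le)
  also have "\<dots> \<le> norm (fm r (\<phi> (real n * r) w)) * (growth 0 * (\<Prod>k<n. norm (fm r (\<phi> (real k * r) w))))"
    by (intro mult_left_mono Suc) auto
  finally show ?case by (simp add: mult_ac)
qed

text \<open>Both ends are rounded down, and the piece before \<open>a\<close> is undone by its
  inverse. The grid part is thus a difference of values of one function \<open>S\<close>, also when
  no grid point lies between \<open>a\<close> and \<open>b\<close>.\<close>

lemma ln_norm_fm_le_grid:
  assumes w: "w \<in> W" and r: "0 < r" and ab: "0 \<le> a" "a \<le> b"
  defines "S \<equiv> \<lambda>t. \<Sum>k<nat \<lfloor>t / r\<rfloor>. ln (norm (fm r (\<phi> (real k * r) w)))"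
  shows "ln (norm (fm (b - a) (\<phi> a w))) \<le> 3 * ln (growth r) + S b - S a"
proof -
  define i where "i = nat \<lfloor>a / r\<rfloor>"
  define j where "j = nat \<lfloor>b / r\<rfloor>"
  have "0 \<le> a / r" "0 \<le> b / r" "a / r \<le> b / r" using ab r by (auto simp: divide_right_mono)
  then have fl: "real i \<le> a / r" "a / r < real i + 1" "real j \<le> b / r" "b / r < real j + 1" and ij: "i \<le> j"
    unfolding i_def j_def by (linarith | simp add: nat_mono floor_mono)+
  have ai: "0 \<le> a - real i * r" "a - real i * r \<le> r" and bj: "0 \<le> b - real j * r" "b - real j * r \<le> r"
    using fl r by (simp_all add: field_simps)
  define n where "n = j - i"
  have j_eq: "j = i + n" using ij by (simp add: n_def)
  define v where "v k = \<phi> (real k * r) w" for k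
  have vW: "v k \<in> W" for k using w r by (simp add: v_def flow_in)
  have vk: "\<phi> (real k * r) (v i) = v (i + k)" for k
    using flow_add[of "real k * r" "real i * r" w] w r by (simp add: v_def algebra_simps)
  have aW: "\<phi> a w \<in> W" using ab w by (simp add: flow_in)
  define Z where "Z = fm (b - a) (\<phi> a w)"
  have va: "\<phi> (a - real i * r) (v i) = \<phi> a w"
    using flow_add[of "a - real i * r" "real i * r" w] ai w r by (simp add: v_def)
  have "Z ** fm (a - real i * r) (v i) = fm ((b - a) + (a - real i * r)) (v i)"
    unfolding Z_def va[symmetric] using ab ai vW by (intro fm_add[symmetric]) auto
  also have "\<dots> = fm ((b - real j * r) + real n * r) (v i)" by (simp add: j_eq algebra_simps)
  also have "\<dots> = fm (b - real j * r) (v j) ** fm (real n * r) (v i)"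
    using fm_add[of "v i" "b - real j * r" "real n * r"] vW bj r by (simp add: vk j_eq)
  finally have "Z ** fm (a - real i * r) (v i) ** fmi (a - real i * r) (v i)
      = fm (b - real j * r) (v j) ** fm (real n * r) (v i) ** fmi (a - real i * r) (v i)" by simp
  then have Z: "Z = fm (b - real j * r) (v j) ** fm (real n * r) (v i) ** fmi (a - real i * r) (v i)"
    using fm_fmi[OF vW ai(1)] by (simp flip: matrix_mul_assoc)
  have "norm Z \<le> norm (fm (b - real j * r) (v j)) * norm (fm (real n * r) (v i)) * norm (fmi (a - real i * r) (v i))"
    unfolding Z by (intro order.trans[OF norm_matrix_matrix_mult_le] mult_right_mono norm_matrix_matrix_mult_le norm_ge_zero)
  \<comment> \<open>The three factors bound the piece after the last grid point, the identity that
    starts the grid product, and the inverse of the piece before \<open>a\<close>.\<close>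
  also have "\<dots> \<le> growth r * (growth r * (\<Prod>k<n. norm (fm r (v (i + k))))) * growth r"
  proof (intro mult_mono)
    show "norm (fm (b - real j * r) (v j)) \<le> growth r"
      using norm_fm_le[OF vW bj(1)] growth_mono[OF bj(2)] order_trans by blast
    show "norm (fmi (a - real i * r) (v i)) \<le> growth r"
      using norm_fmi_le[OF vW ai(1)] growth_mono[OF ai(2)] order_trans by blast
    have "norm (fm (real n * r) (v i)) \<le> growth 0 * (\<Prod>k<n. norm (fm r (v (i + k))))"
      using norm_fm_multiple_le[OF vW, of r n i] r by (simp add: vk)
    also have "\<dots> \<le> growth r * (\<Prod>k<n. norm (fm r (v (i + k))))"
      using r by (intro mult_right_mono growth_mono prod_nonneg) auto
    finally show "norm (fm (real n * r) (v i)) \<le> growth r * (\<Prod>k<n. norm (fm r (v (i + k))))" .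
  qed (use growth_pos[of r] in \<open>auto intro!: mult_nonneg_nonneg prod_nonneg simp: less_imp_le\<close>)
  finally have le: "norm Z \<le> growth r ^ 3 * (\<Prod>k<n. norm (fm r (v (i + k))))"
    by (simp add: power3_eq_cube mult_ac)
  have pos: "0 < norm (fm r (v k))" for k using fm_nonzero[OF vW, of r k] r by simp
  have "0 < norm Z" using fm_nonzero[OF aW, of "b - a"] ab by (simp add: Z_def)
  with le have "ln (norm Z) \<le> ln (growth r ^ 3 * (\<Prod>k<n. norm (fm r (v (i + k)))))" by (intro ln_mono) auto
  also have "\<dots> = ln (growth r ^ 3) + ln (\<Prod>k<n. norm (fm r (v (i + k))))"
    using growth_pos[of r] pos by (intro ln_mult_pos zero_less_power prod_pos) auto
  also have "ln (\<Prod>k<n. norm (fm r (v (i + k)))) = (\<Sum>k<n. ln (norm (fm r (v (i + k)))))"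
    using pos by (intro ln_prod) auto
  also have "\<dots> = (\<Sum>k<j. ln (norm (fm r (v k)))) - (\<Sum>k<i. ln (norm (fm r (v k))))"
    unfolding j_eq by (rule sum_shift_nat)
  also have "\<dots> = S b - S a" by (simp only: S_def v_def i_def j_def)
  finally show ?thesis using growth_pos[of r] by (simp add: Z_def ln_realpow)
qed

text \<open>With a potential the bounds over any subdivision telescope, leaving \<open>C\<close> per
  segment plus the change over the whole period. \<open>C\<close> and \<open>c\<close> are the same
  for all periodic points, while \<open>S\<close> may depend on the point and the period.\<close>

lemma exists_growth_potential:
  assumes e: "0 < e"
    and bounded: "\<And>Y w \<tau>. continuous_on W Y \<Longrightarrow> (\<And>x. x \<in> W \<Longrightarrow> norm (Y x - X x) \<le> e) \<Longrightarrow>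
      periodic_point W \<phi> w \<tau> \<Longrightarrow> \<exists>K. \<forall>t\<ge>0. norm (fundamental_matrix \<phi> Y t w) \<le> K"
    and decay: "\<And>w \<tau>. periodic_point W \<phi> w \<tau> \<Longrightarrow> \<exists>t\<ge>1. norm (fm t w) < 1/2"
  obtains C c where "0 \<le> C" "0 < c"
    "\<And>w \<tau>. periodic_point W \<phi> w \<tau> \<Longrightarrow> \<exists>S.
       (\<forall>a b. 0 \<le> a \<and> a \<le> b \<longrightarrow> ln (norm (fm (b - a) (\<phi> a w))) \<le> C + S b - S a) \<and>
       S \<tau> - S 0 \<le> - c * \<tau>"
proof -
  obtain k T where k: "0 < k" and T: "1 \<le> T" and long:
    "\<And>w p. w \<in> W \<Longrightarrow> T < p \<Longrightarrow> \<phi> p w = w \<Longrightarrow> (\<And>r. 0 < r \<Longrightarrow> r < p \<Longrightarrow> \<phi> r w \<noteq> w) \<Longrightarrow>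
      \<exists>m>0. T \<le> p / real m \<and> p / real m \<le> 2 * T \<and>
        (\<Sum>j<m. ln (norm (fm (p / real m) (\<phi> (real j * (p / real m)) w)))) \<le> - k * p"
  proof (rule sum_ln_norm_le_of_minimal_period[OF e])
    show "\<exists>K. \<forall>t\<ge>0. norm (fundamental_matrix \<phi> Y t w) \<le> K"
      if "continuous_on W Y" "\<And>x. x \<in> W \<Longrightarrow> norm (Y x - X x) \<le> e" "periodic_point W \<phi> w \<tau>" for Y w \<tau>
      using that by (rule bounded)
  qed (rule that; blast)
  have T0: "0 < T" using T by simp
  obtain C1 c1 where C1: "0 < C1" and c1: "0 < c1" and short:
    "\<And>w r t. w \<in> W \<Longrightarrow> 0 < r \<Longrightarrow> r \<le> T \<Longrightarrow> \<phi> r w = w \<Longrightarrow> 0 \<le> t \<Longrightarrow> norm (fm t w) \<le> C1 * exp (- c1 * t)"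
  proof (rule short_period_decay[OF T0])
    show "\<exists>t\<ge>1. norm (fm t w) < 1/2" if "periodic_point W \<phi> w \<tau>" for w \<tau>
      using that by (rule decay)
  qed (rule that; blast)
  \<comment> \<open>Covers short periods by \<open>ln C1\<close> and the rounding cost for grid
    steps up to \<open>2 * T\<close>; 0 makes it nonnegative.\<close>
  define C where "C = max 0 (max (ln C1) (3 * ln (growth (2 * T))))"
  define c where "c = min c1 k"
  show thesis
  proof (rule that[of C c])
    fix w \<tau> assume per: "periodic_point W \<phi> w \<tau>"
    then have w: "w \<in> W" and \<tau>: "0 < \<tau>" "\<phi> \<tau> w = w" by (auto simp: periodic_point_def)
    show "\<exists>S. (\<forall>a b. 0 \<le> a \<and> a \<le> b \<longrightarrow> ln (norm (fm (b - a) (\<phi> a w))) \<le> C + S b - S a) \<and>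
       S \<tau> - S 0 \<le> - c * \<tau>"
    proof (cases "\<exists>r. 0 < r \<and> r \<le> T \<and> \<phi> r w = w")
      case True
      then obtain r where r: "0 < r" "r \<le> T" "\<phi> r w = w" by blast
      have "ln (norm (fm (b - a) (\<phi> a w))) \<le> C + (- c1 * b) - (- c1 * a)" if ab: "0 \<le> a" "a \<le> b" for a b
      proof -
        have aW: "\<phi> a w \<in> W" using ab w by (simp add: flow_in)
        have "\<phi> r (\<phi> a w) = \<phi> a w"
          using flow_add[of r a w] flow_add[of a r w] r ab w by (simp add: add.commute)
        then have "norm (fm (b - a) (\<phi> a w)) \<le> C1 * exp (- c1 * (b - a))"
          using short[OF aW r(1,2)] ab by simp
        moreover have "0 < norm (fm (b - a) (\<phi> a w))" using fm_nonzero[OF aW] ab by simp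
        ultimately have "ln (norm (fm (b - a) (\<phi> a w))) \<le> ln (C1 * exp (- c1 * (b - a)))"
          by (intro ln_mono) auto
        also have "\<dots> = ln C1 + - c1 * (b - a)" using C1 by (simp add: ln_mult_pos)
        also have "\<dots> \<le> C + - c1 * (b - a)" by (simp add: C_def)
        finally show ?thesis by (simp add: algebra_simps)
      qed
      moreover have "c * \<tau> \<le> c1 * \<tau>" using \<tau> by (intro mult_right_mono) (auto simp: c_def)
      \<comment> \<open>Uniform exponential decay corresponds to a linear potential.\<close>
      ultimately show ?thesis by (intro exI[of _ "\<lambda>t. - c1 * t"]) auto
    next
      case False
      then obtain p n where p: "T < p" "\<phi> p w = w" "\<And>r. 0 < r \<Longrightarrow> r < p \<Longrightarrow> \<phi> r w \<noteq> w"
        and n: "\<tau> = real n * p"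
        using exists_minimal_period[OF w \<tau> T0] by metis
      obtain m where m: "0 < m" "T \<le> p / real m" "p / real m \<le> 2 * T"
        "(\<Sum>j<m. ln (norm (fm (p / real m) (\<phi> (real j * (p / real m)) w)))) \<le> - k * p"
        using long[OF w p] by blast
      define r where "r = p / real m"
      have r: "0 < r" and mr: "real m * r = p" using m T0 by (auto simp: r_def)
      define f where "f j = ln (norm (fm r (\<phi> (real j * r) w)))" for j
      define S where "S t = (\<Sum>j<nat \<lfloor>t / r\<rfloor>. f j)" for t
      \<comment> \<open>One period is exactly \<open>m\<close> grid steps, so \<tau> consists of
        \<open>n\<close> identical rounds and \<open>S \<tau>\<close> is \<open>n\<close> times the
        sum over one.\<close>
      have f_period: "f (i * m + j) = f j" for i j
      proof -
        have "\<phi> (real j * r + real i * p) w = \<phi> (real j * r) (\<phi> (real i * p) w)"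
          using r p T0 w by (intro flow_add) auto
        also have "\<dots> = \<phi> (real j * r) w" using p T0 w by (subst flow_multiple_period) auto
        also have "real j * r + real i * p = real (i * m + j) * r" by (simp add: mr[symmetric] algebra_simps)
        finally show ?thesis by (simp add: f_def)
      qed
      have S_mult: "(\<Sum>j<i * m. f j) = real i * (\<Sum>j<m. f j)" for i
      proof (induction i)
        case (Suc i)
        have "(\<Sum>j<i * m + m. f j) = (\<Sum>j<i * m. f j) + (\<Sum>j<m. f j)"
          using sum_shift_nat[of f "i * m" m] by (simp add: f_period)
        then show ?case using Suc by (simp add: algebra_simps)
      qed simp
      have "\<tau> / r = real (n * m)" using r by (simp add: n mr[symmetric])
      then have "S \<tau> = real n * (\<Sum>j<m. f j)" using S_mult[of n] by (simp only: S_def floor_of_nat nat_int)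
      also have "\<dots> \<le> real n * (- k * p)" using m(4) by (intro mult_left_mono) (auto simp: f_def r_def)
      also have "\<dots> = - k * \<tau>" by (simp add: n)
      also have "\<dots> \<le> - c * \<tau>" using \<tau> by (simp add: c_def)
      finally have "S \<tau> - S 0 \<le> - c * \<tau>" by (simp add: S_def)
      moreover have "ln (norm (fm (b - a) (\<phi> a w))) \<le> C + S b - S a" if ab: "0 \<le> a" "a \<le> b" for a b
      proof -
        have "ln (growth r) \<le> ln (growth (2 * T))"
          using m(3) growth_pos growth_mono by (intro ln_mono) (auto simp: r_def)
        then have "3 * ln (growth r) \<le> C" by (simp add: C_def)
        then show ?thesis using ln_norm_fm_le_grid[OF w r ab] by (simp add: S_def f_def)
      qed
      ultimately show ?thesis by (intro exI[of _ S]) auto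
    qed
  qed (use c1 k in \<open>auto simp: C_def c_def\<close>)
qed

end

section \<open>Assembly in the induced norm\<close>

theorem theorem1p9:
  fixes N :: "real^'n \<Rightarrow> real"
    and W :: "'w::metric_space set"
    and \<phi> :: "real \<Rightarrow> 'w \<Rightarrow> 'w"
    and X :: "'w \<Rightarrow> real^'n^'n"
  assumes "vector_norm N"
    and "compact W"
    and "continuous_semiflow_on W \<phi>"
    and "continuous_on W X"
    and "robustly_periodically_stable N W \<phi> X"
  shows "\<exists>\<eta> T :: real. \<eta> < 0 \<and> T > 0 \<and>
    (\<forall>w \<pi>\<^sub>w (l :: nat) (t :: nat \<Rightarrow> real).
       periodic_point W \<phi> w \<pi>\<^sub>w \<and> \<pi>\<^sub>w \<ge> T \<and>
       l \<ge> 1 \<and> t 0 = 0 \<and> t l = \<pi>\<^sub>w \<and>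
       (\<forall>k\<in>{1..l}. t (k - 1) < t k) \<and>
       (\<forall>k\<in>{1..l}. t k - t (k - 1) \<ge> T) \<longrightarrow>
       (1 / \<pi>\<^sub>w) * (\<Sum>k = 1..l.
          ln (matrix_norm N (fundamental_matrix \<phi> X (t k - t (k - 1)) (\<phi> (t (k - 1)) w)))) \<le> \<eta>)"
proof -
  interpret linear_skew_product W \<phi> X using assms by unfold_locales
  obtain C0 where C0: "0 < C0" "\<And>A. matrix_norm N A \<le> C0 * norm A" "\<And>A. norm A \<le> C0 * matrix_norm N A"
    by (rule matrix_norm_equivalent[OF assms(1)]) (rule that)
  obtain \<epsilon> where \<epsilon>: "0 < \<epsilon>" "\<And>Y w \<tau>. continuous_on W Y \<Longrightarrow> sup_norm_on N W (\<lambda>w. X w - Y w) < \<epsilon> \<Longrightarrow>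
      periodic_point W \<phi> w \<tau> \<Longrightarrow> \<exists>K \<gamma>. K > 0 \<and> 0 < \<gamma> \<and> \<gamma> < 1 \<and>
        (\<forall>t\<ge>0. matrix_norm N (fundamental_matrix \<phi> Y t w) \<le> K * \<gamma> powr t)"
    using assms(5) unfolding robustly_periodically_stable_def by blast
  \<comment> \<open>The 2 turns \<open>C0 * e\<close> into half of \<epsilon>, giving the strict
    inequality that robustness asks for.\<close>
  define e where "e = \<epsilon> / (2 * C0)"
  have e: "0 < e" using \<epsilon> C0 by (simp add: e_def)
  have stable: "\<exists>K \<gamma>. K > 0 \<and> 0 < \<gamma> \<and> \<gamma> < 1 \<and> (\<forall>t\<ge>0. norm (fundamental_matrix \<phi> Y t w) \<le> K * \<gamma> powr t)"
    if Y: "continuous_on W Y" "\<And>x. x \<in> W \<Longrightarrow> norm (Y x - X x) \<le> e" and per: "periodic_point W \<phi> w \<tau>" for Y w \<tau>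
  proof -
    have "sup_norm_on N W (\<lambda>w. X w - Y w) \<le> C0 * e"
      unfolding sup_norm_on_def
    proof (rule cSUP_least)
      \<comment> \<open>The supremum needs a nonempty \<open>W\<close>, and the periodic point
        provides an element.\<close>
      show "W \<noteq> {}" using per by (auto simp: periodic_point_def)
      fix x assume "x \<in> W"
      then have "C0 * norm (X x - Y x) \<le> C0 * e" using Y(2)[of x] C0 by (simp add: norm_minus_commute)
      then show "matrix_norm N (X x - Y x) \<le> C0 * e" using C0(2) order_trans by blast
    qed
    also have "\<dots> < \<epsilon>" using C0 \<epsilon> by (simp add: e_def)
    finally obtain K \<gamma> where K: "0 < K" "0 < \<gamma>" "\<gamma> < 1"
      "\<And>t. t \<ge> 0 \<Longrightarrow> matrix_norm N (fundamental_matrix \<phi> Y t w) \<le> K * \<gamma> powr t"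
      using \<epsilon>(2)[OF Y(1) _ per] by metis
    have "norm (fundamental_matrix \<phi> Y t w) \<le> (C0 * K) * \<gamma> powr t" if "0 \<le> t" for t
    proof -
      have "C0 * matrix_norm N (fundamental_matrix \<phi> Y t w) \<le> C0 * (K * \<gamma> powr t)"
        using K(4)[OF that] C0(1) by (intro mult_left_mono) auto
      then show ?thesis using C0(3)[of "fundamental_matrix \<phi> Y t w"] by simp
    qed
    then show ?thesis using K C0(1) by (intro exI[of _ "C0 * K"] exI[of _ \<gamma>]) auto
  qed
  have bounded: "\<exists>K. \<forall>t\<ge>0. norm (fundamental_matrix \<phi> Y t w) \<le> K"
    if Y: "continuous_on W Y" "\<And>x. x \<in> W \<Longrightarrow> norm (Y x - X x) \<le> e" "periodic_point W \<phi> w \<tau>" for Y w \<tau>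
  proof -
    obtain K \<gamma> where K: "0 < K" "0 < \<gamma>" "\<gamma> < 1" "\<And>t. t \<ge> 0 \<Longrightarrow> norm (fundamental_matrix \<phi> Y t w) \<le> K * \<gamma> powr t"
      using stable[OF Y] by metis
    have "norm (fundamental_matrix \<phi> Y t w) \<le> K" if t: "0 \<le> t" for t
    proof -
      have "\<gamma> powr t \<le> 1" using K t by (simp add: powr_le1)
      then have "K * \<gamma> powr t \<le> K * 1" using K by (intro mult_left_mono) auto
      with K(4)[OF t] show ?thesis by simp
    qed
    then show ?thesis by blast
  qed
  have decay: "\<exists>t\<ge>1. norm (fm t w) < 1/2" if per: "periodic_point W \<phi> w \<tau>" for w \<tau>
  proof -
    obtain K \<gamma> where K: "0 < K" "0 < \<gamma>" "\<gamma> < 1" "\<And>t. t \<ge> 0 \<Longrightarrow> norm (fm t w) \<le> K * \<gamma> powr t"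
      using stable[OF assms(4) _ per] e by (metis diff_self less_imp_le norm_zero)
    obtain n where n: "\<gamma> ^ n < 1 / (2 * K)" using real_arch_pow_inv[of "1 / (2 * K)" \<gamma>] K by auto
    \<comment> \<open>\<open>Suc n\<close> instead of \<open>n\<close> makes the time at least 1,
      the progress on which the induction for short periods relies.\<close>
    have "\<gamma> powr real (Suc n) \<le> \<gamma> ^ n" using K by (simp add: powr_realpow mult_left_le_one_le del: of_nat_Suc)
    with n have "\<gamma> powr real (Suc n) < 1 / (2 * K)" by linarith
    then have "K * \<gamma> powr real (Suc n) < 1/2" using K by (simp add: field_simps)
    then show ?thesis using K(4)[of "real (Suc n)"] by (intro exI[of _ "real (Suc n)"]) auto
  qed
  obtain C c where C: "0 \<le> C" and c: "0 < c" and pot: "\<And>w \<tau>. periodic_point W \<phi> w \<tau> \<Longrightarrow> \<exists>S.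
       (\<forall>a b. 0 \<le> a \<and> a \<le> b \<longrightarrow> ln (norm (fm (b - a) (\<phi> a w))) \<le> C + S b - S a) \<and> S \<tau> - S 0 \<le> - c * \<tau>"
  proof (rule exists_growth_potential[OF e])
    show "\<exists>K. \<forall>t\<ge>0. norm (fundamental_matrix \<phi> Y t w) \<le> K"
      if "continuous_on W Y" "\<And>x. x \<in> W \<Longrightarrow> norm (Y x - X x) \<le> e" "periodic_point W \<phi> w \<tau>" for Y w \<tau>
      using that by (rule bounded)
    show "\<exists>t\<ge>1. norm (fm t w) < 1/2" if "periodic_point W \<phi> w \<tau>" for w \<tau>
      using that by (rule decay)
  qed (rule that; blast)
  \<comment> \<open>Cost of one segment, including the passage from the Frobenius norm to the
    induced norm.\<close>
  define D where "D = C + max 0 (ln C0)"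
  have D: "0 \<le> D" using C by (simp add: D_def)
  \<comment> \<open>Segments this long pay for themselves: \<open>D\<close> is at most half of the
    decay \<open>c * T\<close>. The \<open>+ 1\<close> keeps \<open>T\<close> positive when
    \<open>D = 0\<close>.\<close>
  define T where "T = 2 * D / c + 1"
  have T: "0 < T" using D c by (simp add: T_def add_nonneg_pos)
  have DT: "D \<le> (c / 2) * T" using c by (simp add: T_def field_simps)
  show ?thesis
  proof (rule exI[of _ "- (c / 2)"], rule exI[of _ T], intro conjI allI impI)
    fix w p and l :: nat and t :: "nat \<Rightarrow> real"
    assume *: "periodic_point W \<phi> w p \<and> p \<ge> T \<and> l \<ge> 1 \<and> t 0 = 0 \<and> t l = p \<and>
       (\<forall>k\<in>{1..l}. t (k - 1) < t k) \<and> (\<forall>k\<in>{1..l}. t k - t (k - 1) \<ge> T)"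
    then have w: "w \<in> W" and p: "0 < p" by (auto simp: periodic_point_def)
    obtain S where S: "\<And>a b. 0 \<le> a \<Longrightarrow> a \<le> b \<Longrightarrow> ln (norm (fm (b - a) (\<phi> a w))) \<le> C + S b - S a"
      "S p - S 0 \<le> - c * p" using pot * by metis
    have tk: "real k * T \<le> t k" if "k \<le> l" for k
      using that
    proof (induction k)
      case (Suc k)
      have "T \<le> t (Suc k) - t k" using * Suc.prems by force
      with Suc show ?case by (simp add: algebra_simps)
    qed (use * in simp)
    have t0: "0 \<le> t k" if "k \<le> l" for k using tk[OF that] T by (metis mult_nonneg_nonneg of_nat_0_le_iff order_trans less_imp_le)
    have segment: "ln (matrix_norm N (fm (t k - t (k - 1)) (\<phi> (t (k - 1)) w))) \<le> D + (S (t k) - S (t (k - 1)))"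
      if k: "k \<in> {1..l}" for k
    proof -
      let ?M = "fm (t k - t (k - 1)) (\<phi> (t (k - 1)) w)"
      have le: "t (k - 1) \<le> t k" using * k by (meson less_imp_le)
      have tk0: "0 \<le> t (k - 1)" using t0[of "k - 1"] k by auto
      have "?M \<noteq> 0" using le tk0 w by (intro fm_nonzero flow_in) auto
      then have pos: "0 < norm ?M" by simp
      then have "0 < C0 * matrix_norm N ?M" using C0(3)[of ?M] by linarith
      then have "0 < matrix_norm N ?M" using C0(1) by (simp add: zero_less_mult_iff)
      then have "ln (matrix_norm N ?M) \<le> ln (C0 * norm ?M)" using C0(2)[of ?M] by (intro ln_mono) auto
      also have "\<dots> = ln C0 + ln (norm ?M)" using C0(1) pos by (intro ln_mult_pos)
      also have "\<dots> \<le> D + (S (t k) - S (t (k - 1)))" using S(1)[OF tk0 le] by (simp add: D_def)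
      finally show ?thesis .
    qed
    have tel: "(\<Sum>k = 1..n. S (t k) - S (t (k - 1))) = S (t n) - S (t 0)" for n
      by (induction n) auto
    have "(\<Sum>k = 1..l. ln (matrix_norm N (fm (t k - t (k - 1)) (\<phi> (t (k - 1)) w))))
        \<le> (\<Sum>k = 1..l. D + (S (t k) - S (t (k - 1))))"
      by (intro sum_mono segment)
    also have "\<dots> = real l * D + (S p - S 0)" using * by (simp only: sum.distrib tel) simp
    \<comment> \<open>The \<open>l\<close> segments fit into \<open>[0, p]\<close>, so
      \<open>l * T \<le> p\<close> and their total cost uses up at most half of the decay over the
      period.\<close>
    also have "\<dots> \<le> (c / 2) * p - c * p"
    proof -
      have "real l * D \<le> real l * ((c / 2) * T)" using DT by (intro mult_left_mono) auto
      also have "\<dots> = (c / 2) * (real l * T)" by simp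
      also have "\<dots> \<le> (c / 2) * p" using tk[of l] * c by (intro mult_left_mono) auto
      finally show ?thesis using S(2) by simp
    qed
    finally have "(\<Sum>k = 1..l. ln (matrix_norm N (fm (t k - t (k - 1)) (\<phi> (t (k - 1)) w)))) \<le> - (c / 2) * p"
      by (simp add: field_simps)
    then show "(1 / p) * (\<Sum>k = 1..l. ln (matrix_norm N (fm (t k - t (k - 1)) (\<phi> (t (k - 1)) w)))) \<le> - (c / 2)"
      using p by (simp add: field_simps)
  qed (use c T in auto)
qed

end
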